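(* Let $\mathbf{y}[k]\in\mathbb{R}^n$, $k\ge0$, be a stationary process that is $L$-mixing with respect to $(\mathcal{F},\mathcal{F}^+)$, and let $1\le K\le M$ be integers. Consider the online algorithm: $\hat{\boldsymbol{\mu}}_0=0$, $\hat{\boldsymbol{\Phi}}_0(s)$ arbitrary, and for $j\ge0$, $$\hat{\boldsymbol{\mu}}_{j+1}=\hat{\boldsymbol{\mu}}_j+\alpha_j(\bar{\mathbf{y}}_j-\hat{\boldsymbol{\mu}}_j),\qquad \hat{\boldsymbol{\Phi}}_{j+1}(s)=\hat{\boldsymbol{\Phi}}_j(s)+\alpha_j\big(\Delta\hat{\mathbf{y}}_j(s)\Delta\hat{\mathbf{y}}_j(s)^\star-\hat{\boldsymbol{\Phi}}_j(s)\big),$$ with $\alpha_j=\frac{1}{j+1}$ and $\Delta\hat{\mathbf{y}}_j(s)=\hat{\mathbf{y}}_j(s)-h(s)\hat{\boldsymbol{\mu}}_j$. Then for all integers $k\ge2$, all $s\in\mathbb{R}$, and all $q\ge1$, $$\big\|\hat{\boldsymbol{\Phi}}_k(s)-\bar{\Phi}(s)\big\|_{L_q}\le b_q\frac{1}{\sqrt{k}}+\big(M_{4q}(\mathbf{y})^2+2c_{1,2q}M_{4q}(\mathbf{y})\big)\frac{M}{k},$$ where $b_q=4\sqrt{6(2q-1)c_{1,2q}^3c_{2,2q}}+6c_{1,2q}c_{2q}+2c_{2q}^2$, with $c_{1,q}=4\sqrt{(2q-1)M_{2q}(\mathbf{y})\Gamma_{d,2q}(\mathbf{y})}$, $c_{2,q}=2\big(\lfloor\frac{M-1}{K}\rfloor+1\big)c_{1,q}+\big(\lfloor\frac{M-1}{K}\rfloor+1\big)\Gamma_{d,2q}(\mathbf{y})$,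 and $c_q=c_{1,q}\big(\lfloor\frac{M-1}{K}\rfloor+1\big)$ (each evaluated with $q$ replaced by $2q$ as indicated).
   Context: Probability space with a monotone increasing family of $\sigma$-algebras $\mathcal{F}=(\mathcal{F}_k)_{k\ge0}$ and a monotone decreasing family $\mathcal{F}^+=(\mathcal{F}_k^+)_{k\ge0}$ such that $\mathcal{F}_k$ and $\mathcal{F}_k^+$ are independent for every $k$. For a random variable $\mathbf{x}$ in a finite-dimensional real or complex inner product space (Euclidean norm for vectors, Frobenius norm for matrices) and $q\ge1$, $\|\mathbf{x}\|_{L_q}=(\mathbb{E}\|\mathbf{x}\|^q)^{1/q}$. A process $(\mathbf{x}_k)_{k\ge0}$ is $L$-mixing with respect to $(\mathcal{F},\mathcal{F}^+)$ if: $\mathbf{x}_k$ is $\mathcal{F}_k$-measurable for all $k$; $M_q(\mathbf{x}):=\sup_{k\ge0}\|\mathbf{x}_k\|_{L_q}<\infty$ for all $q\ge1$; and $\Gamma_{d,q}(\mathbf{x}):=\sum_{\tau=0}^\infty\gamma_q(\tau,\mathbf{x})<\infty$ for all $q\ge1$, where $\gamma_q(\tau,\mathbf{x})=\sup_{k\ge\tau}\|\mathbf{x}_k-\mathbb{E}[\mathbf{x}_k\mid\mathcal{F}^+_{k-\tau}]\|_{L_q}$. Setup: $\mathbf{y}[k]\in\mathbb{R}^n$ is stationary with mean $\mu=\mathbb{E}[\mathbf{y}[k]]$. Fix integers $1\le K\le M$ and, for each $s\in\mathbb{R}$, complex weights $w_0(s),\dots,w_{M-1}(s)$ with $\sum_{k=0}^{M-1}|w_k(s)|^2=1$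 (e.g. Bartlett: $K=M$, $w_k(s)=M^{-1/2}e^{-j2\pi ks}$; Welch: $w_k(s)=\frac{v_k}{\|v\|_2}e^{-j2\pi ks}$ for a fixed nonzero $v\in\mathbb{R}^M$). Define for $i\ge0$: $\bar{\mathbf{y}}_i=\frac1M\sum_{k=0}^{M-1}\mathbf{y}[iK+k]$, $\hat{\mathbf{y}}_i(s)=\sum_{k=0}^{M-1}w_k(s)\mathbf{y}[iK+k]$, $h(s)=\sum_{k=0}^{M-1}w_k(s)$, and $\bar{\Phi}(s)=\mathbb{E}\big[(\hat{\mathbf{y}}_i(s)-h(s)\mu)(\hat{\mathbf{y}}_i(s)-h(s)\mu)^\star\big]$ (independent of $i$ by stationarity); $\star$ denotes conjugate transpose. *)

theory Defs
  imports "HOL-Probability.Probability"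
begin

text \<open>L_q norm (E norm(x)^q)^(1/q), valued in ennreal (infinity if E norm(x)^q is infinite).
  For vectors the norm of real^'n / complex^'n is Euclidean; for matrices complex^'n^'n it is
  the Frobenius norm.\<close>
definition Lq_norm :: "'a measure \<Rightarrow> real \<Rightarrow> ('a \<Rightarrow> 'b::real_normed_vector) \<Rightarrow> ennreal" where
  "Lq_norm M q X =
     (let I = (\<integral>\<^sup>+ \<omega>. ennreal (norm (X \<omega>) powr q) \<partial>M)
      in if I = \<infinity> then \<infinity> else ennreal (enn2real I powr (1 / q)))"

definition vcond_exp :: "'a measure \<Rightarrow> 'a measure \<Rightarrow> ('a \<Rightarrow> real^'n) \<Rightarrow> 'a \<Rightarrow> real^'n" where
  "vcond_exp M G X = (\<lambda>\<omega>. \<chi> i. real_cond_exp M G (\<lambda>w. X w $ i) \<omega>)"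

definition Mq :: "'a measure \<Rightarrow> real \<Rightarrow> (nat \<Rightarrow> 'a \<Rightarrow> real^'n) \<Rightarrow> ennreal" where
  "Mq M q x = (SUP k. Lq_norm M q (x k))"

definition gamma_q :: "'a measure \<Rightarrow> (nat \<Rightarrow> 'a measure) \<Rightarrow> real \<Rightarrow> nat \<Rightarrow> (nat \<Rightarrow> 'a \<Rightarrow> real^'n) \<Rightarrow> ennreal" where
  "gamma_q M Fp q \<tau> x =
     (SUP k\<in>{\<tau>..}. Lq_norm M q (\<lambda>\<omega>. x k \<omega> - vcond_exp M (Fp (k - \<tau>)) (x k) \<omega>))"

definition Gamma_d :: "'a measure \<Rightarrow> (nat \<Rightarrow> 'a measure) \<Rightarrow> real \<Rightarrow> (nat \<Rightarrow> 'a \<Rightarrow> real^'n) \<Rightarrow> ennreal" where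
  "Gamma_d M Fp q x = (\<Sum>\<tau>. gamma_q M Fp q \<tau> x)"

definition filtration_pair :: "'a measure \<Rightarrow> (nat \<Rightarrow> 'a measure) \<Rightarrow> (nat \<Rightarrow> 'a measure) \<Rightarrow> bool" where
  "filtration_pair M F Fp \<longleftrightarrow>
     (\<forall>k. subalgebra M (F k) \<and> subalgebra M (Fp k)) \<and>
     (\<forall>k l. k \<le> l \<longrightarrow> sets (F k) \<subseteq> sets (F l)) \<and>
     (\<forall>k l. k \<le> l \<longrightarrow> sets (Fp l) \<subseteq> sets (Fp k)) \<and>
     (\<forall>k. prob_space.indep_set M (sets (F k)) (sets (Fp k)))"

definition L_mixing :: "'a measure \<Rightarrow> (nat \<Rightarrow> 'a measure) \<Rightarrow> (nat \<Rightarrow> 'a measure) \<Rightarrow> (nat \<Rightarrow> 'a \<Rightarrow> real^'n) \<Rightarrow> bool" where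
  "L_mixing M F Fp x \<longleftrightarrow>
     (\<forall>k. x k \<in> borel_measurable (F k)) \<and>
     (\<forall>q\<ge>1. Mq M q x < \<infinity> \<and> Gamma_d M Fp q x < \<infinity>)"

definition stationary :: "'a measure \<Rightarrow> (nat \<Rightarrow> 'a \<Rightarrow> 'b::topological_space) \<Rightarrow> bool" where
  "stationary M y \<longleftrightarrow>
     (\<forall>k. distr M (Pi\<^sub>M UNIV (\<lambda>_. borel)) (\<lambda>\<omega> t. y (t + k) \<omega>) =
          distr M (Pi\<^sub>M UNIV (\<lambda>_. borel)) (\<lambda>\<omega> t. y t \<omega>))"

definition cvec :: "real^'n \<Rightarrow> complex^'n" where
  "cvec v = (\<chi> i. complex_of_real (v $ i))"

definition outer :: "complex^'n \<Rightarrow> complex^'n \<Rightarrow> complex^'n^'n" where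
  "outer u v = (\<chi> a b. u $ a * cnj (v $ b))"

definition ybar :: "nat \<Rightarrow> nat \<Rightarrow> (nat \<Rightarrow> 'a \<Rightarrow> real^'n) \<Rightarrow> nat \<Rightarrow> 'a \<Rightarrow> real^'n" where
  "ybar K Mb y i \<omega> = (1 / real Mb) *\<^sub>R (\<Sum>k<Mb. y (i * K + k) \<omega>)"

definition yhat :: "nat \<Rightarrow> nat \<Rightarrow> (nat \<Rightarrow> real \<Rightarrow> complex) \<Rightarrow> (nat \<Rightarrow> 'a \<Rightarrow> real^'n) \<Rightarrow> nat \<Rightarrow> real \<Rightarrow> 'a \<Rightarrow> complex^'n" where
  "yhat K Mb w y i s \<omega> = (\<Sum>k<Mb. w k s *s cvec (y (i * K + k) \<omega>))"

definition hw :: "nat \<Rightarrow> (nat \<Rightarrow> real \<Rightarrow> complex) \<Rightarrow> real \<Rightarrow> complex" where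
  "hw Mb w s = (\<Sum>k<Mb. w k s)"

text \<open>bar Phi(s) = E[(hat y_i(s) - h(s) mu)(hat y_i(s) - h(s) mu)^*], taken at i = 0.\<close>
definition Phibar :: "'a measure \<Rightarrow> nat \<Rightarrow> nat \<Rightarrow> (nat \<Rightarrow> real \<Rightarrow> complex) \<Rightarrow> (nat \<Rightarrow> 'a \<Rightarrow> real^'n) \<Rightarrow> real \<Rightarrow> complex^'n^'n" where
  "Phibar M K Mb w y s =
     (let \<mu> = (\<integral>\<omega>. y 0 \<omega> \<partial>M);
          D = (\<lambda>\<omega>. yhat K Mb w y 0 s \<omega> - hw Mb w s *s cvec \<mu>)
      in \<integral>\<omega>. outer (D \<omega>) (D \<omega>) \<partial>M)"

definition c1 :: "'a measure \<Rightarrow> (nat \<Rightarrow> 'a measure) \<Rightarrow> (nat \<Rightarrow> 'a \<Rightarrow> real^'n) \<Rightarrow> real \<Rightarrow> real" where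
  "c1 M Fp y q = 4 * sqrt ((2 * q - 1) * enn2real (Mq M (2 * q) y) * enn2real (Gamma_d M Fp (2 * q) y))"

definition c2 :: "'a measure \<Rightarrow> (nat \<Rightarrow> 'a measure) \<Rightarrow> nat \<Rightarrow> nat \<Rightarrow> (nat \<Rightarrow> 'a \<Rightarrow> real^'n) \<Rightarrow> real \<Rightarrow> real" where
  "c2 M Fp K Mb y q =
     2 * real ((Mb - 1) div K + 1) * c1 M Fp y q
     + real ((Mb - 1) div K + 1) * enn2real (Gamma_d M Fp (2 * q) y)"

definition cc :: "'a measure \<Rightarrow> (nat \<Rightarrow> 'a measure) \<Rightarrow> nat \<Rightarrow> nat \<Rightarrow> (nat \<Rightarrow> 'a \<Rightarrow> real^'n) \<Rightarrow> real \<Rightarrow> real" where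
  "cc M Fp K Mb y q = c1 M Fp y q * real ((Mb - 1) div K + 1)"

definition bq :: "'a measure \<Rightarrow> (nat \<Rightarrow> 'a measure) \<Rightarrow> nat \<Rightarrow> nat \<Rightarrow> (nat \<Rightarrow> 'a \<Rightarrow> real^'n) \<Rightarrow> real \<Rightarrow> real" where
  "bq M Fp K Mb y q =
     4 * sqrt (6 * (2 * q - 1) * (c1 M Fp y (2 * q)) ^ 3 * c2 M Fp K Mb y (2 * q))
     + 6 * c1 M Fp y (2 * q) * cc M Fp K Mb y (2 * q)
     + 2 * (cc M Fp K Mb y (2 * q)) ^ 2"

end

theory Submission
  imports Defs
begin

text \<open>
The engine is a discrete Gerencser inequality in \<open>L\<^sub>p\<close>, \<open>p \<ge> 2\<close>, for sums \<open>S\<^sub>k\<close> of a process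
\<open>u\<^sub>k\<close> approximated by centred \<open>F\<^sup>+\<close>-measurable variables. With the duality map
\<open>J x = \<bar>x\<bar>\<^bsup>p - 2\<^esup> x\<close> one has \<open>E \<bar>S\<^sub>k\<^sub>+\<^sub>1\<bar>\<^bsup>p\<^esup> = E \<langle>J S\<^sub>k\<^sub>+\<^sub>1, S\<^sub>k\<rangle> + E \<langle>J S\<^sub>k\<^sub>+\<^sub>1, u\<^sub>k\<rangle>\<close>. The first term is
bounded by Hoelder; in the second, \<open>J S\<^sub>k\<^sub>+\<^sub>1\<close> is telescoped into increments \<open>J S\<^sub>i\<^sub>+\<^sub>1 - J S\<^sub>i\<close>, each
independent of the approximant of \<open>u\<^sub>k\<close> given \<open>F\<^sup>+\<^sub>i\<close>, so that only the approximation error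
\<open>\<gamma> (k - i)\<close> survives. The inequality is used three times: for the centred windowed transforms
\<open>D\<^sub>j\<close>, for the running mean (whose weights overlap at most \<open>(M - 1) div K + 1\<close> times), and for
\<open>D\<^sub>j D\<^sub>j\<^sup>* - \<Phi>\<close>. Since the step sizes are \<open>1 / (j + 1)\<close>, the estimator is a plain average of the
outer products of \<open>D\<^sub>j\<close> minus the mean error, and expanding these gives the theorem.
\<close>

section \<open>Bounds in \<open>L\<^sub>p\<close>\<close>

text \<open>Stated through the moment in \<open>ennreal\<close>, the bound includes integrability of \<open>\<bar>X\<bar>\<^bsup>p\<^esup>\<close>.\<close>

definition Lp_le :: "'a measure \<Rightarrow> real \<Rightarrow> ('a \<Rightarrow> 'b::euclidean_space) \<Rightarrow> real \<Rightarrow> bool" where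
  "Lp_le M p X a \<longleftrightarrow> X \<in> borel_measurable M \<and> 0 \<le> a \<and>
     (\<integral>\<^sup>+\<omega>. ennreal (norm (X \<omega>) powr p) \<partial>M) \<le> ennreal (a powr p)"

section \<open>Scalar convexity inequalities for real powers\<close>

lemma bernoulli_powr:
  fixes x p :: real
  assumes "0 \<le> x" "1 \<le> p"
  shows "1 + p * (x - 1) \<le> x powr p"
proof (cases "x = 0")
  case False
  \<comment> \<open>Weighted AM-GM for \<open>x powr p\<close> and \<open>1\<close> with weights
    \<open>1 / p\<close> and \<open>1 - 1 / p\<close>; the left side collapses to
    \<open>x\<close>.\<close>
  have "(x powr p) powr (1 / p) * 1 powr (1 - 1 / p) \<le> 1 / p * x powr p + (1 - 1 / p) * 1"
    by (rule Youngs_inequality_0) (use assms False in auto)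
  hence "x \<le> x powr p / p + 1 - 1 / p"
    using assms False by (simp add: powr_powr)
  hence "p * x \<le> p * (x powr p / p + 1 - 1 / p)"
    using assms by (intro mult_left_mono) auto
  also have "p * (x powr p / p + 1 - 1 / p) = x powr p + p - 1"
    using assms by (simp add: distrib_left right_diff_distrib)
  finally show ?thesis by (simp add: algebra_simps)
qed (use assms in auto)

text \<open>The tangent of \<open>t powr p\<close> at the mean \<open>w\<close> lies below the
  curve, by Bernoulli at \<open>t / w\<close>. Averaging the tangent over \<open>u\<close> and
  \<open>v\<close> returns its value at \<open>w\<close>.\<close>

lemma powr_convex_nonneg:
  fixes u v \<theta> p :: real
  assumes "0 \<le> u" "0 \<le> v" "0 \<le> \<theta>" "\<theta> \<le> 1" "1 \<le> p"
  shows "(\<theta> * u + (1 - \<theta>) * v) powr p \<le> \<theta> * u powr p + (1 - \<theta>) * v powr p"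
proof -
  define w where "w = \<theta> * u + (1 - \<theta>) * v"
  have "w \<ge> 0" using assms by (simp add: w_def)
  show ?thesis
  proof (cases "w = 0")
    case False
    hence w: "w > 0" using \<open>w \<ge> 0\<close> by simp
    have *: "w powr p * (1 + p * (t / w - 1)) \<le> t powr p" if "t \<ge> 0" for t
    proof -
      have "w powr p * (1 + p * (t / w - 1)) \<le> w powr p * (t / w) powr p"
        using that w assms by (intro mult_left_mono bernoulli_powr) auto
      thus ?thesis using that w by (simp add: powr_divide)
    qed
    have "\<theta> * (w powr p * (1 + p * (u / w - 1))) + (1 - \<theta>) * (w powr p * (1 + p * (v / w - 1)))
         \<le> \<theta> * u powr p + (1 - \<theta>) * v powr p"
      using assms by (intro add_mono mult_left_mono *) auto
    also have "\<theta> * (w powr p * (1 + p * (u / w - 1))) + (1 - \<theta>) * (w powr p * (1 + p * (v / w - 1)))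
       = w powr p * (1 + p * ((\<theta> * u + (1 - \<theta>) * v) / w - 1))"
      by (simp add: add_divide_distrib) (simp add: algebra_simps)
    also have "\<dots> = w powr p" using w by (simp flip: w_def)
    finally show ?thesis by (simp add: w_def)
  next
    case True
    thus ?thesis using assms by (simp flip: w_def)
  qed
qed

text \<open>Weighted AM-GM with weights \<open>(p - 2) / p\<close>, \<open>1 / p\<close>,
  \<open>1 / p\<close>: the pointwise form of Hoelder's inequality for the exponents
  \<open>p / (p - 2)\<close>, \<open>p\<close>, \<open>p\<close>, in a shape that still makes sense
  at \<open>p = 2\<close>.\<close>

lemma young_three:
  fixes x y z p :: real
  assumes "0 \<le> x" "0 \<le> y" "0 \<le> z" "2 \<le> p"
  shows "x powr (p - 2) * y * z \<le> (p - 2) / p * x powr p + y powr p / p + z powr p / p"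
proof (cases "x = 0 \<or> y = 0 \<or> z = 0")
  case True
  \<comment> \<open>Since \<open>0 powr 0 = 0\<close>, the left side vanishes for
    \<open>x = 0\<close> even at \<open>p = 2\<close>.\<close>
  hence "x powr (p - 2) * y * z = 0" by auto
  moreover have "0 \<le> (p - 2) / p * x powr p + y powr p / p + z powr p / p"
    using assms by (intro add_nonneg_nonneg) auto
  ultimately show ?thesis by linarith
next
  case False
  hence pos: "x > 0" "y > 0" "z > 0" using assms by auto
  \<comment> \<open>\<open>m\<close> is the logarithm of the product. The tangent of
    \<open>exp\<close> at \<open>m\<close> is evaluated at \<open>p * ln x\<close>,
    \<open>p * ln y\<close> and \<open>p * ln z\<close>, whose weighted mean is
    \<open>m\<close>.\<close>
  define m where "m = (p - 2) * ln x + ln y + ln z"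
  have *: "exp m * (1 + (p * ln t - m)) \<le> t powr p" if "t > 0" for t
  proof -
    have "exp m * (1 + (p * ln t - m)) \<le> exp m * exp (p * ln t - m)"
      by (intro mult_left_mono exp_ge_add_one_self) auto
    also have "\<dots> = t powr p"
      using that by (simp add: powr_def flip: exp_add)
    finally show ?thesis .
  qed
  have "x powr (p - 2) * y * z = exp m"
    using pos by (simp add: m_def exp_add powr_def)
  also have "\<dots> = (p - 2) / p * (exp m * (1 + (p * ln x - m)))
     + exp m * (1 + (p * ln y - m)) / p + exp m * (1 + (p * ln z - m)) / p"
  proof -
    have "(p - 2) / p * (exp m * (1 + (p * ln x - m)))
     + exp m * (1 + (p * ln y - m)) / p + exp m * (1 + (p * ln z - m)) / p
      = exp m * (((p - 2) * (1 + (p * ln x - m)) + (1 + (p * ln y - m)) + (1 + (p * ln z - m))) / p)"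
      using assms by (simp add: field_simps)
    also have "(p - 2) * (1 + (p * ln x - m)) + (1 + (p * ln y - m)) + (1 + (p * ln z - m))
       = p * (1 - m + ((p - 2) * ln x + ln y + ln z))"
      by (simp add: algebra_simps)
    also have "\<dots> = p" by (simp flip: m_def)
    finally show ?thesis using assms by simp
  qed
  also have "\<dots> \<le> (p - 2) / p * x powr p + y powr p / p + z powr p / p"
    using assms pos by (intro add_mono mult_left_mono divide_right_mono *) auto
  finally show ?thesis .
qed

section \<open>Calculus of moment bounds: scaling, Minkowski and Hoelder\<close>

lemma Lp_le_measurable [measurable_dest]: "Lp_le M p X a \<Longrightarrow> X \<in> borel_measurable M"
  and Lp_le_nonneg: "Lp_le M p X a \<Longrightarrow> 0 \<le> a"
  by (auto simp: Lp_le_def)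

lemma Lp_le_integrable:
  assumes "Lp_le M p X a"
  shows "integrable M (\<lambda>\<omega>. norm (X \<omega>) powr p)" "(\<integral>\<omega>. norm (X \<omega>) powr p \<partial>M) \<le> a powr p"
proof -
  note [measurable] = Lp_le_measurable[OF assms]
  have fin: "(\<integral>\<^sup>+\<omega>. ennreal (norm (X \<omega>) powr p) \<partial>M) \<le> ennreal (a powr p)"
    using assms by (simp add: Lp_le_def)
  show int: "integrable M (\<lambda>\<omega>. norm (X \<omega>) powr p)"
    using fin by (intro integrableI_nonneg) (auto simp: less_top[symmetric] top_unique)
  show "(\<integral>\<omega>. norm (X \<omega>) powr p \<partial>M) \<le> a powr p"
    using fin nn_integral_eq_integral[OF int] by simp
qed

lemma Lp_leI:
  assumes "X \<in> borel_measurable M" "0 \<le> a" "integrable M g"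
    "\<And>\<omega>. \<omega> \<in> space M \<Longrightarrow> norm (X \<omega>) powr p \<le> g \<omega>" "(\<integral>\<omega>. g \<omega> \<partial>M) \<le> a powr p"
  shows "Lp_le M p X a"
proof -
  have nn: "0 \<le> g \<omega>" if "\<omega> \<in> space M" for \<omega>
    using assms(4)[OF that] by (meson order_trans powr_ge_zero)
  have "(\<integral>\<^sup>+\<omega>. ennreal (norm (X \<omega>) powr p) \<partial>M) \<le> (\<integral>\<^sup>+\<omega>. ennreal (g \<omega>) \<partial>M)"
    using assms by (intro nn_integral_mono) (auto simp: ennreal_leI)
  also have "\<dots> = ennreal (\<integral>\<omega>. g \<omega> \<partial>M)"
    using assms nn by (intro nn_integral_eq_integral) auto
  also have "\<dots> \<le> ennreal (a powr p)" using assms by (intro ennreal_leI)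
  finally show ?thesis using assms by (simp add: Lp_le_def)
qed

lemma Lp_le_weaken:
  assumes "Lp_le M p X a" "a \<le> b" "0 \<le> p"
  shows "Lp_le M p X b"
proof -
  have "ennreal (a powr p) \<le> ennreal (b powr p)"
    using assms by (intro ennreal_leI powr_mono2) (auto simp: Lp_le_def)
  thus ?thesis using assms unfolding Lp_le_def by (meson order_trans)
qed

lemma Lp_le_scale:
  assumes "Lp_le M p X a" "Y \<in> borel_measurable M" "\<And>\<omega>. norm (Y \<omega>) \<le> c * norm (X \<omega>)" "0 \<le> p" "0 \<le> c"
  shows "Lp_le M p Y (c * a)"
proof (rule Lp_leI[where g = "\<lambda>\<omega>. c powr p * norm (X \<omega>) powr p"])
  show "integrable M (\<lambda>\<omega>. c powr p * norm (X \<omega>) powr p)"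
    using Lp_le_integrable(1)[OF assms(1)] by simp
  show "norm (Y \<omega>) powr p \<le> c powr p * norm (X \<omega>) powr p" for \<omega>
    using powr_mono2[OF assms(4) norm_ge_zero assms(3)[of \<omega>]] assms by (simp add: powr_mult)
  show "(\<integral>\<omega>. c powr p * norm (X \<omega>) powr p \<partial>M) \<le> (c * a) powr p"
    using Lp_le_integrable(2)[OF assms(1)] Lp_le_nonneg[OF assms(1)] assms
    by (simp add: powr_mult mult_left_mono)
qed (use assms Lp_le_nonneg[OF assms(1)] in auto)

text \<open>The proofs of Minkowski and Cauchy-Schwarz divide by the bounds, which must then be
  positive. This limit restores the case of a zero bound.\<close>

lemma Lp_leI_eps:
  assumes "\<And>e. 0 < e \<Longrightarrow> Lp_le M p X (a + e)" "0 \<le> a" "0 < p"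
  shows "Lp_le M p X a"
proof -
  have X: "X \<in> borel_measurable M" using assms(1)[of 1] by (simp add: Lp_le_def)
  have int: "integrable M (\<lambda>\<omega>. norm (X \<omega>) powr p)"
    using Lp_le_integrable(1)[OF assms(1)[of 1]] by simp
  have "((\<lambda>e. (a + e) powr p) \<longlongrightarrow> (a + 0) powr p) (at_right 0)"
    using assms by (intro tendsto_powr' tendsto_intros) (auto simp: eventually_at_right_less
      intro!: eventually_mono[OF eventually_at_right_less])
  hence "(\<integral>\<omega>. norm (X \<omega>) powr p \<partial>M) \<le> (a + 0) powr p"
  proof (rule tendsto_lowerbound)
    show "\<forall>\<^sub>F e in at_right 0. (\<integral>\<omega>. norm (X \<omega>) powr p \<partial>M) \<le> (a + e) powr p"
      using Lp_le_integrable(2)[OF assms(1)] by (intro eventually_mono[OF eventually_at_right_less]) auto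
  qed simp
  thus ?thesis using X int assms by (intro Lp_leI[OF X _ int]) auto
qed

text \<open>Minkowski: \<open>norm X + norm Y\<close> is \<open>s\<close> times the convex
  combination of \<open>norm X / a'\<close> and \<open>norm Y / b'\<close> with weights
  \<open>a' / s\<close> and \<open>b' / s\<close>, so convexity of the power applies
  pointwise.\<close>

lemma Lp_le_add:
  assumes X: "Lp_le M p X a" and Y: "Lp_le M p Y b" and p: "1 \<le> p"
  shows "Lp_le M p (\<lambda>\<omega>. X \<omega> + Y \<omega>) (a + b)"
proof (rule Lp_leI_eps)
  fix e :: real assume e: "0 < e"
  define a' b' where "a' = a + e / 2" and "b' = b + e / 2"
  have pos: "a' > 0" "b' > 0"
    using e Lp_le_nonneg[OF X] Lp_le_nonneg[OF Y] by (auto simp: a'_def b'_def)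
  have X': "Lp_le M p X a'" and Y': "Lp_le M p Y b'"
    using X Y e p by (auto intro: Lp_le_weaken simp: a'_def b'_def)
  note [measurable] = Lp_le_measurable[OF X] Lp_le_measurable[OF Y]
  define s where "s = a' + b'"
  have s: "s > 0" using pos by (simp add: s_def)
  have b_frac: "1 - a' / s = b' / s" using s by (simp add: s_def field_simps)
  define g where "g \<omega> = s powr p * (a' / s * (norm (X \<omega>) powr p / a' powr p)
     + (1 - a' / s) * (norm (Y \<omega>) powr p / b' powr p))" for \<omega>
  have "Lp_le M p (\<lambda>\<omega>. X \<omega> + Y \<omega>) s"
  proof (rule Lp_leI[where g = g])
    show "integrable M g"
      using Lp_le_integrable(1)[OF X] Lp_le_integrable(1)[OF Y] unfolding g_def by auto
    fix \<omega>
    have "norm (X \<omega> + Y \<omega>) \<le> norm (X \<omega>) + norm (Y \<omega>)" by (rule norm_triangle_ineq)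
    also have "\<dots> = s * (a' / s * (norm (X \<omega>) / a') + (1 - a' / s) * (norm (Y \<omega>) / b'))"
      using pos s by (simp add: b_frac) (simp add: field_simps)
    finally have "norm (X \<omega> + Y \<omega>) powr p
       \<le> (s * (a' / s * (norm (X \<omega>) / a') + (1 - a' / s) * (norm (Y \<omega>) / b'))) powr p"
      using p by (intro powr_mono2) auto
    also have "\<dots> = s powr p * (a' / s * (norm (X \<omega>) / a') + (1 - a' / s) * (norm (Y \<omega>) / b')) powr p"
      using pos s by (subst powr_mult) (auto simp: s_def field_simps)
    also have "\<dots> \<le> s powr p * (a' / s * (norm (X \<omega>) / a') powr p + (1 - a' / s) * (norm (Y \<omega>) / b') powr p)"
      using pos s p by (intro mult_left_mono powr_convex_nonneg) (auto simp: s_def)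
    also have "\<dots> = g \<omega>" using pos by (simp add: g_def powr_divide)
    finally show "norm (X \<omega> + Y \<omega>) powr p \<le> g \<omega>" .
  next
    have "(\<integral>\<omega>. g \<omega> \<partial>M) = s powr p * (a' / s * ((\<integral>\<omega>. norm (X \<omega>) powr p \<partial>M) / a' powr p)
     + (1 - a' / s) * ((\<integral>\<omega>. norm (Y \<omega>) powr p \<partial>M) / b' powr p))"
      unfolding g_def using Lp_le_integrable(1)[OF X] Lp_le_integrable(1)[OF Y] by simp
    also have "\<dots> \<le> s powr p * (a' / s * 1 + (1 - a' / s) * 1)"
      using Lp_le_integrable(2)[OF X'] Lp_le_integrable(2)[OF Y'] pos s
      by (intro mult_left_mono add_mono) (auto simp: s_def)
    finally show "(\<integral>\<omega>. g \<omega> \<partial>M) \<le> s powr p" by simp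
  qed (use s in auto)
  thus "Lp_le M p (\<lambda>\<omega>. X \<omega> + Y \<omega>) (a + b + e)" by (simp add: s_def a'_def b'_def algebra_simps)
qed (use Lp_le_nonneg[OF X] Lp_le_nonneg[OF Y] p in auto)

lemma Lp_le_zero: "0 < p \<Longrightarrow> 0 \<le> a \<Longrightarrow> Lp_le M p (\<lambda>_. 0) a"
  by (simp add: Lp_le_def)

lemma Lp_le_sum:
  assumes "finite I" "\<And>i. i \<in> I \<Longrightarrow> Lp_le M p (X i) (a i)" "1 \<le> p"
  shows "Lp_le M p (\<lambda>\<omega>. \<Sum>i\<in>I. X i \<omega>) (\<Sum>i\<in>I. a i)"
  using assms by (induction I rule: finite_induct) (auto intro!: Lp_le_zero Lp_le_add)

lemma Lp_le_minus: "Lp_le M p X a \<Longrightarrow> Lp_le M p (\<lambda>\<omega>. - X \<omega>) a"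
  by (auto simp: Lp_le_def)

lemma Lp_le_diff:
  assumes "Lp_le M p X a" "Lp_le M p Y b" "1 \<le> p"
  shows "Lp_le M p (\<lambda>\<omega>. X \<omega> - Y \<omega>) (a + b)"
  using Lp_le_add[OF assms(1) Lp_le_minus[OF assms(2)] assms(3)] by simp

text \<open>Cauchy-Schwarz, from \<open>2 * u * v \<le> u\<^sup>2 + v\<^sup>2\<close> for the
  normalised powers. It is stated for any \<open>Z\<close> dominated by the product of norms, so
  that it serves for outer products.\<close>

lemma Lp_le_mult:
  assumes X: "Lp_le M (2 * p) X a" and Y: "Lp_le M (2 * p) Y b" and p: "1 \<le> p"
    and Z: "Z \<in> borel_measurable M" "\<And>\<omega>. norm (Z \<omega>) \<le> norm (X \<omega>) * norm (Y \<omega>)"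
  shows "Lp_le M p Z (a * b)"
proof -
  have *: "Lp_le M p Z (a' * b')"
    if X': "Lp_le M (2 * p) X a'" and Y': "Lp_le M (2 * p) Y b'" and pos: "a' > 0" "b' > 0" for a' b'
  proof -
    define g where "g \<omega> = a' powr p * b' powr p / 2 * (norm (X \<omega>) powr (2 * p) / a' powr (2 * p)
      + norm (Y \<omega>) powr (2 * p) / b' powr (2 * p))" for \<omega>
    show ?thesis
    proof (rule Lp_leI[where g = g])
      show "integrable M g"
        using Lp_le_integrable(1)[OF X] Lp_le_integrable(1)[OF Y] unfolding g_def by auto
      fix \<omega>
      define u v where "u = norm (X \<omega>) powr p / a' powr p" and "v = norm (Y \<omega>) powr p / b' powr p"
      have sq: "t powr (2 * p) = (t powr p)\<^sup>2" for t :: real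
        by (simp only: powr_add power2_eq_square mult_2)
      have "norm (Z \<omega>) powr p \<le> (norm (X \<omega>) * norm (Y \<omega>)) powr p"
        using p by (intro powr_mono2 Z) auto
      also have "\<dots> = a' powr p * b' powr p * (u * v)"
        using pos by (simp add: powr_mult u_def v_def)
      also have "\<dots> \<le> a' powr p * b' powr p * ((u\<^sup>2 + v\<^sup>2) / 2)"
        using sum_squares_bound[of u v] by (intro mult_left_mono) auto
      also have "\<dots> = g \<omega>"
        by (simp add: g_def u_def v_def sq power_divide)
      finally show "norm (Z \<omega>) powr p \<le> g \<omega>" .
    next
      have "(\<integral>\<omega>. g \<omega> \<partial>M) = a' powr p * b' powr p / 2 * ((\<integral>\<omega>. norm (X \<omega>) powr (2 * p) \<partial>M) / a' powr (2 * p)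
        + (\<integral>\<omega>. norm (Y \<omega>) powr (2 * p) \<partial>M) / b' powr (2 * p))"
        unfolding g_def using Lp_le_integrable(1)[OF X] Lp_le_integrable(1)[OF Y] by simp
      also have "\<dots> \<le> a' powr p * b' powr p / 2 * (1 + 1)"
        using Lp_le_integrable(2)[OF X'] Lp_le_integrable(2)[OF Y'] pos
        by (intro mult_left_mono add_mono) auto
      also have "\<dots> = (a' * b') powr p" using pos by (simp add: powr_mult)
      finally show "(\<integral>\<omega>. g \<omega> \<partial>M) \<le> (a' * b') powr p" .
    qed (use pos Z in auto)
  qed
  show ?thesis
  proof (rule Lp_leI_eps)
    fix e :: real assume e: "0 < e"
    \<comment> \<open>As \<open>d \<le> 1\<close>, \<open>(a + d) * (b + d)\<close> is at most
      \<open>a * b + d * (a + b + 1)\<close>; the other bound on \<open>d\<close> makes the excess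
      at most \<open>e\<close>.\<close>
    define d where "d = min 1 (e / (a + b + 1))"
    have nn: "0 \<le> a" "0 \<le> b" using Lp_le_nonneg[OF X] Lp_le_nonneg[OF Y] by auto
    have d: "0 < d" "d \<le> 1" using e nn by (auto simp: d_def)
    have "d \<le> e / (a + b + 1)" by (simp add: d_def)
    hence d': "d * (a + b + 1) \<le> e" using nn by (simp add: pos_le_divide_eq)
    have "d * d \<le> d * 1" using d by (intro mult_left_mono) auto
    hence "(a + d) * (b + d) \<le> a * b + e" using d' by (simp add: algebra_simps)
    moreover have "Lp_le M p Z ((a + d) * (b + d))"
      using X Y d nn p by (intro * Lp_le_weaken[OF X] Lp_le_weaken[OF Y]) auto
    ultimately show "Lp_le M p Z (a * b + e)" using p by (auto intro: Lp_le_weaken)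
  qed (use Lp_le_nonneg[OF X] Lp_le_nonneg[OF Y] p in auto)
qed

text \<open>\<open>young_three\<close> integrated after normalising by \<open>s\<close>,
  \<open>a'\<close>, \<open>b'\<close>; bounds \<open>a\<close>, \<open>b\<close> equal to 0 are
  reached as limits of positive ones. The weight \<open>norm S powr (p - 2)\<close> times two
  further factors is what increments of the duality map produce.\<close>

lemma Holder_three:
  assumes S: "Lp_le M p S s" and U: "Lp_le M p U a" and V: "Lp_le M p V b" and p: "2 \<le> p" and s: "0 < s"
  shows "integrable M (\<lambda>\<omega>. norm (S \<omega>) powr (p - 2) * norm (U \<omega>) * norm (V \<omega>))"
    and "(\<integral>\<omega>. norm (S \<omega>) powr (p - 2) * norm (U \<omega>) * norm (V \<omega>) \<partial>M) \<le> s powr (p - 2) * a * b"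
proof -
  note [measurable] = Lp_le_measurable[OF S] Lp_le_measurable[OF U] Lp_le_measurable[OF V]
  note int = Lp_le_integrable(1)[OF S] Lp_le_integrable(1)[OF U] Lp_le_integrable(1)[OF V]
  show I: "integrable M (\<lambda>\<omega>. norm (S \<omega>) powr (p - 2) * norm (U \<omega>) * norm (V \<omega>))"
  proof (rule Bochner_Integration.integrable_bound)
    show "integrable M (\<lambda>\<omega>. (p - 2) / p * norm (S \<omega>) powr p + norm (U \<omega>) powr p / p + norm (V \<omega>) powr p / p)"
      using int by auto
    show "AE \<omega> in M. norm (norm (S \<omega>) powr (p - 2) * norm (U \<omega>) * norm (V \<omega>))
       \<le> norm ((p - 2) / p * norm (S \<omega>) powr p + norm (U \<omega>) powr p / p + norm (V \<omega>) powr p / p)"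
    proof (rule AE_I2)
      fix \<omega>
      show "norm (norm (S \<omega>) powr (p - 2) * norm (U \<omega>) * norm (V \<omega>))
       \<le> norm ((p - 2) / p * norm (S \<omega>) powr p + norm (U \<omega>) powr p / p + norm (V \<omega>) powr p / p)"
        using young_three[of "norm (S \<omega>)" "norm (U \<omega>)" "norm (V \<omega>)" p] p by (simp add: abs_mult)
    qed
  qed auto
  have *: "(\<integral>\<omega>. norm (S \<omega>) powr (p - 2) * norm (U \<omega>) * norm (V \<omega>) \<partial>M) \<le> s powr (p - 2) * a' * b'"
    if U': "Lp_le M p U a'" and V': "Lp_le M p V b'" and pos: "a' > 0" "b' > 0" for a' b'
  proof -
    let ?c = "s powr (p - 2) * a' * b'"
    have "(\<integral>\<omega>. norm (S \<omega>) powr (p - 2) * norm (U \<omega>) * norm (V \<omega>) \<partial>M)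
       \<le> (\<integral>\<omega>. ?c * ((p - 2) / p * (norm (S \<omega>) powr p / s powr p)
              + norm (U \<omega>) powr p / a' powr p / p + norm (V \<omega>) powr p / b' powr p / p) \<partial>M)"
    proof (rule integral_mono[OF I])
      fix \<omega>
      have "norm (S \<omega>) powr (p - 2) * norm (U \<omega>) * norm (V \<omega>)
         = ?c * ((norm (S \<omega>) / s) powr (p - 2) * (norm (U \<omega>) / a') * (norm (V \<omega>) / b'))"
        using s pos by (simp add: powr_divide)
      also have "\<dots> \<le> ?c * ((p - 2) / p * (norm (S \<omega>) / s) powr p + (norm (U \<omega>) / a') powr p / p + (norm (V \<omega>) / b') powr p / p)"
        using s pos p by (intro mult_left_mono young_three) auto
      also have "\<dots> = ?c * ((p - 2) / p * (norm (S \<omega>) powr p / s powr p)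
              + norm (U \<omega>) powr p / a' powr p / p + norm (V \<omega>) powr p / b' powr p / p)"
        using s pos by (simp add: powr_divide)
      finally show "norm (S \<omega>) powr (p - 2) * norm (U \<omega>) * norm (V \<omega>) \<le> \<dots>" .
    qed (use int in auto)
    also have "\<dots> = ?c * ((p - 2) / p * ((\<integral>\<omega>. norm (S \<omega>) powr p \<partial>M) / s powr p)
              + (\<integral>\<omega>. norm (U \<omega>) powr p \<partial>M) / a' powr p / p + (\<integral>\<omega>. norm (V \<omega>) powr p \<partial>M) / b' powr p / p)"
      using int by simp
    also have "\<dots> \<le> ?c * ((p - 2) / p * 1 + 1 / p + 1 / p)"
      using Lp_le_integrable(2)[OF S] Lp_le_integrable(2)[OF U'] Lp_le_integrable(2)[OF V'] s pos p
      by (intro mult_left_mono add_mono divide_right_mono) auto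
    also have "(p - 2) / p * 1 + 1 / p + 1 / p = 1" using p by (simp add: field_simps)
    finally show ?thesis by simp
  qed
  have "((\<lambda>e. s powr (p - 2) * (a + e) * (b + e)) \<longlongrightarrow> s powr (p - 2) * (a + 0) * (b + 0)) (at_right 0)"
    by (intro tendsto_intros)
  hence "(\<integral>\<omega>. norm (S \<omega>) powr (p - 2) * norm (U \<omega>) * norm (V \<omega>) \<partial>M) \<le> s powr (p - 2) * (a + 0) * (b + 0)"
  proof (rule tendsto_lowerbound)
    show "\<forall>\<^sub>F e in at_right 0. (\<integral>\<omega>. norm (S \<omega>) powr (p - 2) * norm (U \<omega>) * norm (V \<omega>) \<partial>M)
        \<le> s powr (p - 2) * (a + e) * (b + e)"
      using Lp_le_nonneg[OF U] Lp_le_nonneg[OF V] p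
      by (intro eventually_mono[OF eventually_at_right_less] * Lp_le_weaken[OF U] Lp_le_weaken[OF V]) auto
  qed simp
  thus "(\<integral>\<omega>. norm (S \<omega>) powr (p - 2) * norm (U \<omega>) * norm (V \<omega>) \<partial>M) \<le> s powr (p - 2) * a * b" by simp
qed

text \<open>The bridge to the \<open>ennreal\<close> norm of the theorem: an infinite moment fails
  both sides, and for a finite one taking roots is an equivalence.\<close>

lemma Lq_norm_le_iff:
  assumes [measurable]: "X \<in> borel_measurable M" and a: "0 \<le> a" and p: "1 \<le> p"
  shows "Lq_norm M p X \<le> ennreal a \<longleftrightarrow> Lp_le M p X a"
proof -
  define I where "I = (\<integral>\<^sup>+ \<omega>. ennreal (norm (X \<omega>) powr p) \<partial>M)"
  show ?thesis
  proof (cases "I = \<infinity>")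
    case True
    thus ?thesis by (auto simp: Lq_norm_def Lp_le_def Let_def top_unique simp flip: I_def)
  next
    case False
    then obtain r where r: "I = ennreal r" "r \<ge> 0" by (cases I) auto
    have "Lq_norm M p X \<le> ennreal a \<longleftrightarrow> r powr (1 / p) \<le> a"
      using r a by (simp add: Lq_norm_def Let_def flip: I_def)
    also have "\<dots> \<longleftrightarrow> r \<le> a powr p"
    proof
      assume "r powr (1 / p) \<le> a"
      hence "(r powr (1 / p)) powr p \<le> a powr p" using p by (intro powr_mono2) auto
      thus "r \<le> a powr p" using r p by (cases "r = 0") (auto simp: powr_powr)
    next
      assume "r \<le> a powr p"
      hence "r powr (1 / p) \<le> (a powr p) powr (1 / p)" using p r by (intro powr_mono2) auto
      thus "r powr (1 / p) \<le> a" using a p by (cases "a = 0") (auto simp: powr_powr)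
    qed
    also have "\<dots> \<longleftrightarrow> Lp_le M p X a"
      using r a assms by (simp add: Lp_le_def flip: I_def)
    finally show ?thesis .
  qed
qed

lemma Lq_norm_finite_Lp_le:
  assumes "X \<in> borel_measurable M" "Lq_norm M p X \<le> a" "a < \<infinity>" "1 \<le> p"
  shows "Lp_le M p X (enn2real a)"
  using assms by (subst Lq_norm_le_iff[symmetric]) auto

section \<open>Moment bounds under total mass one\<close>

context prob_space
begin

lemma Lp_le_const: "Lp_le M p (\<lambda>_. c) (norm c)"
  by (simp add: Lp_le_def emeasure_space_1)

text \<open>Cauchy-Schwarz against the constant 1.\<close>

lemma Lp_le_halve:
  assumes "Lp_le M (2 * p) X a" "1 \<le> p"
  shows "Lp_le M p X a"
  using Lp_le_mult[OF assms(1) Lp_le_const[of "2 * p" "1::real"] assms(2), of X] Lp_le_measurable[OF assms(1)]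
  by simp

lemma Lp_le_expectation:
  assumes X: "Lp_le M p X a" and p: "1 \<le> p"
  shows "integrable M X" "norm (expectation X) \<le> a"
proof -
  note [measurable] = Lp_le_measurable[OF X]
  \<comment> \<open>Bernoulli at \<open>norm (X \<omega>) / b\<close>, solved for the norm. If the
    \<open>p\<close>-th moment is at most \<open>b powr p\<close>, the right side has expectation at
    most \<open>b\<close>, which takes the place of Jensen's inequality.\<close>
  have 1: "norm (X \<omega>) \<le> b * (norm (X \<omega>) powr p / b powr p / p + (1 - 1 / p))" if "b > 0" for b \<omega>
  proof -
    have "1 + p * (norm (X \<omega>) / b - 1) \<le> (norm (X \<omega>) / b) powr p"
      using p that by (intro bernoulli_powr) auto
    hence "(1 + p * (norm (X \<omega>) / b - 1)) / p \<le> (norm (X \<omega>) / b) powr p / p"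
      using p by (intro divide_right_mono) auto
    moreover have "(1 + p * (norm (X \<omega>) / b - 1)) / p = norm (X \<omega>) / b - (1 - 1 / p)"
      using p by (simp add: add_divide_distrib)
    ultimately have "norm (X \<omega>) / b \<le> (norm (X \<omega>) / b) powr p / p + (1 - 1 / p)" by simp
    thus ?thesis using that by (simp add: powr_divide pos_divide_le_eq mult.commute)
  qed
  note int = Lp_le_integrable(1)[OF X]
  show IX: "integrable M X"
  proof (rule Bochner_Integration.integrable_bound)
    show "integrable M (\<lambda>\<omega>. norm (X \<omega>) powr p / p + (1 - 1 / p))" using int by auto
    show "AE \<omega> in M. norm (X \<omega>) \<le> norm (norm (X \<omega>) powr p / p + (1 - 1 / p))"
      using 1[of 1] p by auto
  qed auto
  have "expectation (\<lambda>\<omega>. norm (X \<omega>)) \<le> a + e" if e: "e > 0" for e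
  proof -
    have pos: "a + e > 0" using e Lp_le_nonneg[OF X] by simp
    have X': "Lp_le M p X (a + e)" using X e p by (auto intro: Lp_le_weaken)
    have "expectation (\<lambda>\<omega>. norm (X \<omega>))
      \<le> expectation (\<lambda>\<omega>. (a + e) * (norm (X \<omega>) powr p / (a + e) powr p / p + (1 - 1 / p)))"
      using IX int 1[OF pos] by (intro integral_mono) auto
    also have "\<dots> = (a + e) * (expectation (\<lambda>\<omega>. norm (X \<omega>) powr p) / (a + e) powr p / p + (1 - 1 / p))"
      using int by (simp add: prob_space)
    also have "\<dots> \<le> (a + e) * (1 / p + (1 - 1 / p))"
      using Lp_le_integrable(2)[OF X'] pos p by (intro mult_left_mono add_mono divide_right_mono) auto
    finally show ?thesis by simp
  qed
  hence "expectation (\<lambda>\<omega>. norm (X \<omega>)) \<le> a" by (rule field_le_epsilon)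
  thus "norm (expectation X) \<le> a" by (rule order_trans[OF integral_norm_bound])
qed

lemma Lp_le_center:
  assumes X: "Lp_le M p X a" and p: "1 \<le> p"
  shows "Lp_le M p (\<lambda>\<omega>. X \<omega> - expectation X) (2 * a)"
  using Lp_le_diff[OF X Lp_le_weaken[OF Lp_le_const Lp_le_expectation(2)[OF X p]] p] p by simp

end

section \<open>The moment inequality for sums of mixing variables\<close>

text \<open>This is the gradient of \<open>norm x powr p / p\<close>; for \<open>p = 2\<close> it is
  the identity.\<close>

definition dual_powr :: "real \<Rightarrow> 'b::euclidean_space \<Rightarrow> 'b" where
  "dual_powr p x = norm x powr (p - 2) *\<^sub>R x"

lemma dual_powr_zero [simp]: "dual_powr p 0 = 0"
  by (simp add: dual_powr_def)

lemma norm_dual_powr: "norm (dual_powr p x) = norm x powr (p - 2) * norm x"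
  by (simp add: dual_powr_def)

lemma dual_powr_measurable [measurable]: "dual_powr p \<in> borel_measurable borel"
  unfolding dual_powr_def by measurable

lemma inner_dual_powr_self: "2 \<le> p \<Longrightarrow> dual_powr p x \<bullet> x = norm x powr p"
proof -
  assume "2 \<le> p"
  have "norm x powr p = norm x powr (p - 2 + 2)" by simp
  also have "\<dots> = norm x powr (p - 2) * norm x powr 2" by (rule powr_add)
  finally have "norm x powr p = norm x powr (p - 2) * norm x powr 2" .
  thus ?thesis by (simp add: dual_powr_def dot_square_norm)
qed

text \<open>With \<open>t = s / r\<close> this is
  \<open>t * (1 - t powr a) \<le> a * (1 - t)\<close>, which follows from
  \<open>1 - t powr a \<le> - a * ln t \<le> a * (1 / t - 1)\<close>. The factor \<open>s\<close> on
  the left compensates the unbounded derivative of the power near 0 when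
  \<open>a < 1\<close>.\<close>

lemma powr_diff_le:
  fixes r s a :: real
  assumes "0 \<le> s" "s \<le> r" "0 \<le> a"
  shows "s * (r powr a - s powr a) \<le> a * r powr a * (r - s)"
proof (cases "s = 0")
  case False
  define t where "t = s / r"
  have r: "0 < r" "0 < s" using False assms by auto
  hence t: "0 < t" and s: "s = t * r" by (auto simp: t_def)
  have "ln (1 / t) \<le> 1 / t - 1" using t by (intro ln_le_minus_one) auto
  hence "a * (- ln t) \<le> a * (1 / t - 1)" using t assms by (intro mult_left_mono) (auto simp: ln_div)
  moreover have "1 + a * ln t \<le> t powr a"
    using t exp_ge_add_one_self[of "a * ln t"] by (simp add: powr_def)
  ultimately have "t * (1 - t powr a) \<le> t * (a * (1 / t - 1))"
    using t by (intro mult_left_mono) auto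
  also have "\<dots> = a * (1 - t)" using t by (simp add: field_simps)
  finally have "r * r powr a * (t * (1 - t powr a)) \<le> r * r powr a * (a * (1 - t))"
    using r by (intro mult_left_mono) auto
  thus ?thesis using r t by (simp add: s powr_mult algebra_simps)
qed (use assms in auto)

text \<open>The constant \<open>p - 1\<close> is 1 from moving the vector plus \<open>p - 2\<close>
  from moving its weight, with the point of larger norm as base. The sum of the two powers replaces
  their maximum so that Hoelder can treat them one at a time.\<close>

lemma dual_powr_diff_le:
  assumes p: "2 \<le> p"
  shows "norm (dual_powr p x - dual_powr p y)
    \<le> (p - 1) * (norm (x - y) * (norm x powr (p - 2) + norm y powr (p - 2)))"
proof -
  have *: "norm (dual_powr p x - dual_powr p y) \<le> (p - 1) * (norm x powr (p - 2) * norm (x - y))"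
    if yx: "norm y \<le> norm x" for x y :: 'a
  proof -
    let ?a = "p - 2"
    have le: "norm y powr ?a \<le> norm x powr ?a" using p yx by (intro powr_mono2) auto
    have "dual_powr p x - dual_powr p y
        = norm x powr ?a *\<^sub>R (x - y) + (norm x powr ?a - norm y powr ?a) *\<^sub>R y"
      by (simp add: dual_powr_def algebra_simps)
    also have "norm \<dots> \<le> norm x powr ?a * norm (x - y) + norm y * (norm x powr ?a - norm y powr ?a)"
      using le by (intro order_trans[OF norm_triangle_ineq]) (simp add: mult.commute)
    also have "norm y * (norm x powr ?a - norm y powr ?a) \<le> ?a * norm x powr ?a * (norm x - norm y)"
      using p yx by (intro powr_diff_le) auto
    also have "\<dots> \<le> ?a * norm x powr ?a * norm (x - y)"
      using p norm_triangle_ineq2[of x y] by (intro mult_left_mono) auto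
    finally show ?thesis by (simp add: algebra_simps)
  qed
  have "norm (dual_powr p x - dual_powr p y) \<le> (p - 1) * (max (norm x powr (p - 2)) (norm y powr (p - 2)) * norm (x - y))"
  proof (cases "norm y \<le> norm x")
    case True
    have "(p - 1) * (norm x powr (p - 2) * norm (x - y)) \<le> (p - 1) * (max (norm x powr (p - 2)) (norm y powr (p - 2)) * norm (x - y))"
      using p by (intro mult_left_mono mult_right_mono) auto
    thus ?thesis using *[OF True] by linarith
  next
    case False
    have "(p - 1) * (norm y powr (p - 2) * norm (y - x)) \<le> (p - 1) * (max (norm x powr (p - 2)) (norm y powr (p - 2)) * norm (y - x))"
      using p by (intro mult_left_mono mult_right_mono) auto
    thus ?thesis using *[of x y] False by (simp add: norm_minus_commute)
  qed
  also have "\<dots> \<le> (p - 1) * (norm (x - y) * (norm x powr (p - 2) + norm y powr (p - 2)))"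
    using p by (subst mult.commute[of "norm (x - y)"], intro mult_left_mono mult_right_mono) (auto simp: max_def)
  finally show ?thesis .
qed

section \<open>Independence and the inductive moment bound\<close>

context prob_space
begin

text \<open>The inner product is expanded in the orthonormal basis, and each coordinate product
  falls under the product rule for independent real variables.\<close>

lemma indep_set_inner_expectation:
  fixes X Y :: "'a \<Rightarrow> 'b::euclidean_space"
  assumes F: "subalgebra M F" and G: "subalgebra M G" and ind: "indep_set (sets F) (sets G)"
    and X: "X \<in> borel_measurable F" "integrable M X" and Y: "Y \<in> borel_measurable G" "integrable M Y"
  shows "integrable M (\<lambda>\<omega>. X \<omega> \<bullet> Y \<omega>)"
    "expectation (\<lambda>\<omega>. X \<omega> \<bullet> Y \<omega>) = expectation X \<bullet> expectation Y"
proof -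
  have sig: "sigma_sets (space M) {Z -` A \<inter> space M |A. A \<in> sets borel} \<subseteq> sets H"
    if "subalgebra M H" "Z \<in> borel_measurable H" for H and Z :: "'a \<Rightarrow> real"
  proof -
    have sp: "space H = space M" using that by (simp add: subalgebra_def)
    have "{Z -` A \<inter> space H |A. A \<in> sets borel} \<subseteq> sets H"
      using that by (auto intro: measurable_sets)
    from sets.sigma_sets_subset[OF this] show ?thesis by (simp add: sp)
  qed
  have iv: "indep_var borel (\<lambda>\<omega>. X \<omega> \<bullet> b) borel (\<lambda>\<omega>. Y \<omega> \<bullet> b)" for b
  proof -
    have XF: "(\<lambda>\<omega>. X \<omega> \<bullet> b) \<in> borel_measurable F" and YG: "(\<lambda>\<omega>. Y \<omega> \<bullet> b) \<in> borel_measurable G"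
      using X Y by auto
    have "indep_set (sigma_sets (space M) {(\<lambda>\<omega>. X \<omega> \<bullet> b) -` A \<inter> space M |A. A \<in> sets borel})
       (sigma_sets (space M) {(\<lambda>\<omega>. Y \<omega> \<bullet> b) -` A \<inter> space M |A. A \<in> sets borel})"
      using ind sig[OF F XF] sig[OF G YG] unfolding indep_set_def
      by (elim indep_sets_mono_sets) (auto split: bool.splits)
    thus ?thesis
      unfolding indep_var_eq using measurable_from_subalg[OF F XF] measurable_from_subalg[OF G YG] by auto
  qed
  have int: "integrable M (\<lambda>\<omega>. (X \<omega> \<bullet> b) * (Y \<omega> \<bullet> b))"
    and eq: "expectation (\<lambda>\<omega>. (X \<omega> \<bullet> b) * (Y \<omega> \<bullet> b)) = (expectation X \<bullet> b) * (expectation Y \<bullet> b)" for b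
    using indep_var_integrable[OF iv] indep_var_lebesgue_integral[OF iv] X Y by auto
  show "integrable M (\<lambda>\<omega>. X \<omega> \<bullet> Y \<omega>)"
    by (subst euclidean_inner) (use int in auto)
  show "expectation (\<lambda>\<omega>. X \<omega> \<bullet> Y \<omega>) = expectation X \<bullet> expectation Y"
    by (subst (1 2) euclidean_inner) (use int eq in simp)
qed

text \<open>Supplies the norm itself in place of an upper bound, so that \<open>r powr p\<close> can
  be identified with an expectation and bounded in terms of \<open>r\<close>.\<close>

lemma Lp_le_exact:
  assumes "Lp_le M p X a" "0 < p"
  obtains r where "0 \<le> r" "Lp_le M p X r" "expectation (\<lambda>\<omega>. norm (X \<omega>) powr p) = r powr p"
proof
  let ?I = "expectation (\<lambda>\<omega>. norm (X \<omega>) powr p)"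
  have nn: "?I \<ge> 0" by simp
  show "?I powr (1 / p) \<ge> 0" by simp
  show eq: "?I = (?I powr (1 / p)) powr p"
    using nn assms by (cases "?I = 0") (auto simp: powr_powr)
  show "Lp_le M p X (?I powr (1 / p))"
    using assms eq by (intro Lp_leI[OF _ _ Lp_le_integrable(1)[OF assms(1)]]) (auto dest: Lp_le_measurable)
qed

text \<open>\<open>f k\<close> is the scale of the \<open>k\<close>-th summand, so plain sums
  (\<open>f = 1\<close>) and weighted sums are covered together. \<open>V i k\<close> approximates
  \<open>U k\<close> by information independent of \<open>F i\<close>, and \<open>g\<close> measures
  the error by lag.\<close>

lemma L_mixing_sum_bound:
  fixes U :: "nat \<Rightarrow> 'a \<Rightarrow> 'b::euclidean_space" and V :: "nat \<Rightarrow> nat \<Rightarrow> 'a \<Rightarrow> 'b"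
  assumes p: "2 \<le> p"
    and F: "\<And>i. subalgebra M (F i)" and mono: "\<And>i j. i \<le> j \<Longrightarrow> sets (F i) \<subseteq> sets (F j)"
    and G: "\<And>i. subalgebra M (G i)" and ind: "\<And>i. indep_set (sets (F i)) (sets (G i))"
    and UF: "\<And>k. U k \<in> borel_measurable (F k)"
    and VG: "\<And>i k. i \<le> k \<Longrightarrow> V i k \<in> borel_measurable (G i)"
    and V0: "\<And>i k. i \<le> k \<Longrightarrow> expectation (V i k) = 0"
    and f: "\<And>k. 0 \<le> f k" and m: "0 \<le> m" and g: "\<And>k. 0 \<le> g k"
    and U: "\<And>k. Lp_le M p (U k) (f k * m)"
    and UV: "\<And>i k. i \<le> k \<Longrightarrow> Lp_le M p (\<lambda>\<omega>. U k \<omega> - V i k \<omega>) (f k * g (k - i))"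
    and gsum: "\<And>n. (\<Sum>\<tau><n. g \<tau>) \<le> \<Gamma>"
  shows "Lp_le M p (\<lambda>\<omega>. \<Sum>k<n. U k \<omega>) (2 * sqrt ((p - 1) * m * \<Gamma> * (\<Sum>k<n. (f k)\<^sup>2)))"
proof -
  define S where "S = (\<lambda>k \<omega>. \<Sum>i<k. U i \<omega>)"
  \<comment> \<open>\<open>W k\<close> is to bound the squared norm of \<open>S k\<close>;
    \<open>h k\<close> collects the approximation errors of \<open>U k\<close> against all
    increments up to time \<open>k\<close>.\<close>
  define h where "h k = f k * (\<Sum>i\<le>k. f i * g (k - i))" for k
  define W where "W k = 4 * (p - 1) * m * (\<Sum>j<k. h j)" for k
  have h: "h k \<ge> 0" for k using f g by (auto simp: h_def intro!: mult_nonneg_nonneg sum_nonneg)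
  have Wmono: "W i \<le> W j" if "i \<le> j" for i j
    using that h p m unfolding W_def by (intro mult_left_mono sum_mono2) auto
  have W0: "0 \<le> W k" for k using Wmono[of 0 k] by (simp add: W_def)
  have UFj: "U i \<in> borel_measurable (F j)" if "i \<le> j" for i j
    using UF[of i] mono[OF that] F[of i] F[of j] unfolding subalgebra_def
    by (auto simp: measurable_def)
  have SF: "S (Suc i) \<in> borel_measurable (F j)" "S i \<in> borel_measurable (F j)" if "i \<le> j" for i j
    unfolding S_def by (intro borel_measurable_sum UFj; use that in auto)+
  have SM [measurable]: "S i \<in> borel_measurable M" for i
    using SF(2)[of i i] F measurable_from_subalg by blast
  have UM [measurable]: "U i \<in> borel_measurable M" for i
    using UF F measurable_from_subalg by blast
  \<comment> \<open>If the norm \<open>r\<close> of \<open>S (Suc k)\<close> exceeded the claimed bound, it would dominate all earlier norms,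
    so that every power of a partial sum in the Hoelder estimates may be bounded by \<open>r\<close>.\<close>
  have main: "Lp_le M p (S k) (sqrt (W k))" for k
  proof (induction k rule: less_induct)
    case (less k')
    show ?case
    proof (cases k')
      case 0
      thus ?thesis using p by (simp add: S_def W_def Lp_le_zero)
    next
      case (Suc k)
      have SL: "Lp_le M p (S (Suc k)) (sqrt (W k) + f k * m)"
      proof -
        have "Lp_le M p (S k) (sqrt (W k))" using Suc by (intro less) auto
        from Lp_le_add[OF this U[of k]] p show ?thesis by (simp add: S_def)
      qed
      obtain r where r: "0 \<le> r" "Lp_le M p (S (Suc k)) r"
          "expectation (\<lambda>\<omega>. norm (S (Suc k) \<omega>) powr p) = r powr p"
        by (rule Lp_le_exact[OF SL]) (use p in auto)
      show ?thesis
      proof (cases "r \<le> sqrt (W (Suc k))")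
        case True
        thus ?thesis unfolding Suc using p by (intro Lp_le_weaken[OF r(2)]) auto
      next
        case False
        hence rW: "sqrt (W (Suc k)) < r" by simp
        hence r0: "0 < r" using W0[of "Suc k"] by (smt (verit) real_sqrt_ge_zero)
        have Sr: "Lp_le M p (S i) r" if "i \<le> Suc k" for i
        proof (cases "i = Suc k")
          case False
          hence "sqrt (W i) \<le> r" using Wmono[of i "Suc k"] that rW
            by (meson order_trans less_imp_le real_sqrt_le_mono)
          thus ?thesis using that False Suc p by (intro Lp_le_weaken[OF less]) auto
        qed (use r in auto)
        let ?J = "\<lambda>i \<omega>. dual_powr p (S i \<omega>)"
        let ?D = "\<lambda>i \<omega>. ?J (Suc i) \<omega> - ?J i \<omega>"
        define q where "q = r powr (p - 2)"
        have q: "q > 0" using r0 by (simp add: q_def)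
        have Jint: "integrable M (\<lambda>\<omega>. ?J i \<omega> \<bullet> X \<omega>)"
            "expectation (\<lambda>\<omega>. ?J i \<omega> \<bullet> X \<omega>) \<le> q * r * b"
          if i: "i \<le> Suc k" and X: "Lp_le M p X b" for i X b
        proof -
          note [measurable] = Lp_le_measurable[OF X]
          note H = Holder_three[OF Sr[OF i] Sr[OF i] X p r0]
          have b: "norm (?J i \<omega> \<bullet> X \<omega>) \<le> norm (S i \<omega>) powr (p - 2) * norm (S i \<omega>) * norm (X \<omega>)" for \<omega>
            using Cauchy_Schwarz_ineq2[of "?J i \<omega>" "X \<omega>"] by (simp add: norm_dual_powr)
          show I: "integrable M (\<lambda>\<omega>. ?J i \<omega> \<bullet> X \<omega>)"
            by (rule Bochner_Integration.integrable_bound[OF H(1)]) (use b in \<open>auto simp: abs_mult\<close>)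
          have "expectation (\<lambda>\<omega>. ?J i \<omega> \<bullet> X \<omega>) \<le> expectation (\<lambda>\<omega>. norm (S i \<omega>) powr (p - 2) * norm (S i \<omega>) * norm (X \<omega>))"
            by (rule integral_mono[OF I H(1)]) (use b in \<open>auto simp: abs_le_iff\<close>)
          thus "expectation (\<lambda>\<omega>. ?J i \<omega> \<bullet> X \<omega>) \<le> q * r * b"
            using H(2) unfolding q_def by linarith
        qed
        \<comment> \<open>Pairing with constant basis vectors gives integrability of each
          coordinate.\<close>
        have Jint1: "integrable M (?J i)" if i: "i \<le> Suc k" for i
        proof -
          have "integrable M (\<lambda>\<omega>. \<Sum>b\<in>Basis. (?J i \<omega> \<bullet> b) *\<^sub>R b)"
            using Jint(1)[OF i Lp_le_const] by (intro Bochner_Integration.integrable_sum) auto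
          thus ?thesis by (simp add: euclidean_representation)
        qed
        \<comment> \<open>\<open>?D i\<close> is measurable for \<open>F i\<close>, while
          \<open>V i k\<close> is centred and measurable for \<open>G i\<close>; their pairing has
          mean zero and only \<open>U k - V i k\<close> contributes. The Lipschitz bound brings in
          powers of both \<open>S (Suc i)\<close> and \<open>S i\<close>, hence the factor
          2.\<close>
        have Dbound: "expectation (\<lambda>\<omega>. ?D i \<omega> \<bullet> U k \<omega>) \<le> 2 * (p - 1) * m * q * (f k * (f i * g (k - i)))"
          if i: "i \<le> k" for i
        proof -
          let ?Y = "\<lambda>\<omega>. U k \<omega> - V i k \<omega>"
          have VM [measurable]: "V i k \<in> borel_measurable M"
            using VG[OF i] G measurable_from_subalg by blast
          have Vint: "integrable M (V i k)"
            using Bochner_Integration.integrable_diff[OF Lp_le_expectation(1)[OF U[of k]] Lp_le_expectation(1)[OF UV[OF i]]] p by simp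
          have DF: "?D i \<in> borel_measurable (F i)"
            using SF(1)[of i i] SF(2)[of i i] by measurable
          have Dint: "integrable M (?D i)" using Jint1 i by (intro Bochner_Integration.integrable_diff) auto
          note DV = indep_set_inner_expectation[OF F G ind DF Dint VG[OF i] Vint]
          note H1 = Holder_three[OF Sr U[of i] UV[OF i] p r0]
          have H1a: "integrable M (\<lambda>\<omega>. (p - 1) * (norm (S (Suc i) \<omega>) powr (p - 2) * norm (U i \<omega>) * norm (?Y \<omega>)
                 + norm (S i \<omega>) powr (p - 2) * norm (U i \<omega>) * norm (?Y \<omega>)))"
            using H1(1)[of "Suc i"] H1(1)[of i] i by (intro integrable_mult_right Bochner_Integration.integrable_add) auto
          have b: "\<bar>?D i \<omega> \<bullet> ?Y \<omega>\<bar> \<le> (p - 1) * (norm (S (Suc i) \<omega>) powr (p - 2) * norm (U i \<omega>) * norm (?Y \<omega>)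
                 + norm (S i \<omega>) powr (p - 2) * norm (U i \<omega>) * norm (?Y \<omega>))" for \<omega>
          proof -
            have SU: "S (Suc i) \<omega> - S i \<omega> = U i \<omega>" by (simp add: S_def)
            have "\<bar>?D i \<omega> \<bullet> ?Y \<omega>\<bar> \<le> norm (?D i \<omega>) * norm (?Y \<omega>)" by (rule Cauchy_Schwarz_ineq2)
            also have "\<dots> \<le> ((p - 1) * (norm (U i \<omega>) * (norm (S (Suc i) \<omega>) powr (p - 2) + norm (S i \<omega>) powr (p - 2)))) * norm (?Y \<omega>)"
              using dual_powr_diff_le[OF p, of "S (Suc i) \<omega>" "S i \<omega>"] unfolding SU by (rule mult_right_mono) simp
            finally show ?thesis by (simp add: algebra_simps)
          qed
          have DYint: "integrable M (\<lambda>\<omega>. ?D i \<omega> \<bullet> ?Y \<omega>)"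
            by (rule Bochner_Integration.integrable_bound[OF H1a])
              (use b in \<open>auto intro: order_trans[OF _ abs_ge_self]\<close>)
          have "expectation (\<lambda>\<omega>. ?D i \<omega> \<bullet> U k \<omega>) = expectation (\<lambda>\<omega>. ?D i \<omega> \<bullet> ?Y \<omega> + ?D i \<omega> \<bullet> V i k \<omega>)"
            by (simp add: inner_diff_right)
          also have "\<dots> = expectation (\<lambda>\<omega>. ?D i \<omega> \<bullet> ?Y \<omega>)"
            using DYint DV V0[OF i] by (subst Bochner_Integration.integral_add) auto
          also have "\<dots> \<le> expectation (\<lambda>\<omega>. (p - 1) * (norm (S (Suc i) \<omega>) powr (p - 2) * norm (U i \<omega>) * norm (?Y \<omega>)
                 + norm (S i \<omega>) powr (p - 2) * norm (U i \<omega>) * norm (?Y \<omega>)))"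
            by (rule integral_mono[OF DYint H1a]) (use b in \<open>auto simp: abs_le_iff\<close>)
          also have "\<dots> = (p - 1) * (expectation (\<lambda>\<omega>. norm (S (Suc i) \<omega>) powr (p - 2) * norm (U i \<omega>) * norm (?Y \<omega>))
                 + expectation (\<lambda>\<omega>. norm (S i \<omega>) powr (p - 2) * norm (U i \<omega>) * norm (?Y \<omega>)))"
            using H1(1)[of "Suc i"] H1(1)[of i] i by simp
          also have "\<dots> \<le> (p - 1) * (q * (f i * m) * (f k * g (k - i)) + q * (f i * m) * (f k * g (k - i)))"
            using H1(2)[of "Suc i"] H1(2)[of i] i p unfolding q_def by (intro mult_left_mono add_mono) auto
          finally show ?thesis by (simp add: algebra_simps)
        qed
        have "r powr p = expectation (\<lambda>\<omega>. ?J (Suc k) \<omega> \<bullet> S k \<omega> + ?J (Suc k) \<omega> \<bullet> U k \<omega>)"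
        proof -
          have "norm (S (Suc k) \<omega>) powr p = ?J (Suc k) \<omega> \<bullet> S k \<omega> + ?J (Suc k) \<omega> \<bullet> U k \<omega>" for \<omega>
            using inner_dual_powr_self[OF p, of "S (Suc k) \<omega>"] by (simp add: S_def inner_add_right)
          thus ?thesis using r(3) by simp
        qed
        also have "\<dots> = expectation (\<lambda>\<omega>. ?J (Suc k) \<omega> \<bullet> S k \<omega>) + expectation (\<lambda>\<omega>. ?J (Suc k) \<omega> \<bullet> U k \<omega>)"
          using Jint(1)[OF order_refl Sr[of k]] Jint(1)[OF order_refl U[of k]]
          by (intro Bochner_Integration.integral_add) auto
        also have "expectation (\<lambda>\<omega>. ?J (Suc k) \<omega> \<bullet> S k \<omega>) \<le> q * r * sqrt (W k)"
          using less[of k] Suc by (intro Jint(2)) auto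
        also have "expectation (\<lambda>\<omega>. ?J (Suc k) \<omega> \<bullet> U k \<omega>) \<le> 2 * (p - 1) * m * q * h k"
        proof -
          have DUint: "integrable M (\<lambda>\<omega>. ?D i \<omega> \<bullet> U k \<omega>)" if "i < Suc k" for i
            using Jint(1)[OF _ U[of k], of i] Jint(1)[OF _ U[of k], of "Suc i"] that
            by (simp add: inner_diff_left)
          have "?J (Suc k) \<omega> \<bullet> U k \<omega> = (\<Sum>i<Suc k. ?D i \<omega> \<bullet> U k \<omega>)" for \<omega>
          proof -
            have "?J (Suc k) \<omega> - ?J 0 \<omega> = (\<Sum>i<Suc k. ?D i \<omega>)" by (rule sum_lessThan_telescope[symmetric])
            moreover have "?J 0 \<omega> = 0" by (simp add: S_def)
            ultimately show ?thesis by (simp only: inner_sum_left diff_zero)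
          qed
          hence "expectation (\<lambda>\<omega>. ?J (Suc k) \<omega> \<bullet> U k \<omega>) = (\<Sum>i<Suc k. expectation (\<lambda>\<omega>. ?D i \<omega> \<bullet> U k \<omega>))"
            using DUint by (simp only:) (intro Bochner_Integration.integral_sum, auto)
          also have "\<dots> \<le> (\<Sum>i<Suc k. 2 * (p - 1) * m * q * (f k * (f i * g (k - i))))"
            by (intro sum_mono Dbound) auto
          finally show ?thesis by (simp only: h_def lessThan_Suc_atMost sum_distrib_left)
        qed
        finally have "r powr p \<le> q * (r * sqrt (W k) + 2 * (p - 1) * m * h k)"
          by (simp add: algebra_simps)
        moreover have "r powr p = q * r\<^sup>2"
          using r0 powr_add[of r "p - 2" 2] unfolding q_def by simp
        ultimately have "q * r\<^sup>2 \<le> q * (r * sqrt (W k) + 2 * (p - 1) * m * h k)" by simp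
        hence "r\<^sup>2 \<le> r * sqrt (W k) + 2 * (p - 1) * m * h k" using q by simp
        \<comment> \<open>Absorbing \<open>r * sqrt (W k)\<close> into
          \<open>r\<^sup>2 / 2 + W k / 2\<close> doubles the error term, which is why
          \<open>W\<close> carries the factor 4 where the increment bound has 2.\<close>
        moreover have "2 * (r * sqrt (W k)) \<le> r\<^sup>2 + W k"
          using sum_squares_bound[of r "sqrt (W k)"] W0[of k] by simp
        ultimately have "r\<^sup>2 \<le> W k + 2 * (2 * (p - 1) * m * h k)" by linarith
        also have "\<dots> = W (Suc k)" by (simp add: W_def algebra_simps)
        finally have "r \<le> sqrt (W (Suc k))" by (rule real_le_rsqrt)
        with False show ?thesis by simp
      qed
    qed
  qed
  \<comment> \<open>A Schur test: splitting \<open>f i * f j\<close> into half squares leaves row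
    and column sums of \<open>g (j - i)\<close>, each at most \<open>\<Gamma>\<close>.\<close>
  have "(\<Sum>j<n. h j) \<le> \<Gamma> * (\<Sum>k<n. (f k)\<^sup>2)"
  proof -
    have "(\<Sum>j<n. h j) \<le> (\<Sum>j<n. \<Sum>i\<le>j. g (j - i) * ((f j)\<^sup>2 / 2) + g (j - i) * ((f i)\<^sup>2 / 2))"
    proof (rule sum_mono)
      fix j
      have "f j * (f i * g (j - i)) \<le> g (j - i) * ((f j)\<^sup>2 / 2) + g (j - i) * ((f i)\<^sup>2 / 2)" for i
        using mult_left_mono[OF sum_squares_bound[of "f i" "f j"] g[of "j - i"]] by (simp add: algebra_simps)
      thus "h j \<le> (\<Sum>i\<le>j. g (j - i) * ((f j)\<^sup>2 / 2) + g (j - i) * ((f i)\<^sup>2 / 2))"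
        unfolding h_def sum_distrib_left by (intro sum_mono)
    qed
    also have "\<dots> = (\<Sum>j<n. \<Sum>i\<le>j. g (j - i) * ((f j)\<^sup>2 / 2)) + (\<Sum>j<n. \<Sum>i\<le>j. g (j - i) * ((f i)\<^sup>2 / 2))"
      by (simp add: sum.distrib)
    also have "(\<Sum>j<n. \<Sum>i\<le>j. g (j - i) * ((f j)\<^sup>2 / 2)) \<le> (\<Sum>j<n. \<Gamma> * ((f j)\<^sup>2 / 2))"
    proof (rule sum_mono)
      fix j
      have "(\<Sum>i\<le>j. g (j - i)) = (\<Sum>i<Suc j. g i)"
        using sum.nat_diff_reindex[of g "Suc j"] by (simp only: lessThan_Suc_atMost) simp
      also have "\<dots> \<le> \<Gamma>" by (rule gsum)
      finally show "(\<Sum>i\<le>j. g (j - i) * ((f j)\<^sup>2 / 2)) \<le> \<Gamma> * ((f j)\<^sup>2 / 2)"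
        unfolding sum_distrib_right[symmetric] by (intro mult_right_mono) auto
    qed
    also have "(\<Sum>j<n. \<Sum>i\<le>j. g (j - i) * ((f i)\<^sup>2 / 2)) = (\<Sum>i<n. \<Sum>j\<in>{i..<n}. g (j - i) * ((f i)\<^sup>2 / 2))"
      by (subst sum.Sigma, simp, simp, subst sum.Sigma, simp, simp,
          rule sum.reindex_bij_witness[of _ "\<lambda>(i, j). (j, i)" "\<lambda>(i, j). (j, i)"]) auto
    also have "\<dots> \<le> (\<Sum>i<n. \<Gamma> * ((f i)\<^sup>2 / 2))"
    proof (rule sum_mono)
      fix i assume "i \<in> {..<n}"
      hence "(\<Sum>j\<in>{i..<n}. g (j - i)) = (\<Sum>\<tau><n - i. g \<tau>)"
        by (intro sum.reindex_bij_witness[of _ "\<lambda>t. t + i" "\<lambda>j. j - i"]) auto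
      also have "\<dots> \<le> \<Gamma>" by (rule gsum)
      finally show "(\<Sum>j\<in>{i..<n}. g (j - i) * ((f i)\<^sup>2 / 2)) \<le> \<Gamma> * ((f i)\<^sup>2 / 2)"
        unfolding sum_distrib_right[symmetric] by (intro mult_right_mono) auto
    qed
    also have "(\<Sum>j<n. \<Gamma> * ((f j)\<^sup>2 / 2)) + (\<Sum>i<n. \<Gamma> * ((f i)\<^sup>2 / 2)) = \<Gamma> * (\<Sum>k<n. (f k)\<^sup>2)"
      by (simp add: sum_distrib_left flip: sum.distrib)
    finally show ?thesis by simp
  qed
  hence "4 * (p - 1) * m * (\<Sum>j<n. h j) \<le> 4 * (p - 1) * m * (\<Gamma> * (\<Sum>k<n. (f k)\<^sup>2))"
    by (rule mult_left_mono) (use p m in simp)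
  hence "W n \<le> 4 * ((p - 1) * m * \<Gamma> * (\<Sum>k<n. (f k)\<^sup>2))"
    unfolding W_def by (simp only: mult.assoc)
  hence "sqrt (W n) \<le> 2 * sqrt ((p - 1) * m * \<Gamma> * (\<Sum>k<n. (f k)\<^sup>2))"
    using real_sqrt_le_mono[of "W n"] real_sqrt_mult[of 4] by fastforce
  thus ?thesis using Lp_le_weaken[OF main[of n]] p by (simp add: S_def)
qed

end

section \<open>Windowed transforms of a stationary mixing process\<close>

lemma cvec_diff: "cvec (u - v) = cvec u - cvec v"
  and cvec_add: "cvec (u + v) = cvec u + cvec v"
  and cvec_zero [simp]: "cvec 0 = 0"
  and cvec_scaleR: "cvec (r *\<^sub>R u) = complex_of_real r *s cvec u"
  by (auto simp: cvec_def vec_eq_iff)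

lemma cvec_sum: "cvec (\<Sum>i\<in>I. u i) = (\<Sum>i\<in>I. cvec (u i))"
  by (induction I rule: infinite_finite_induct) (auto simp: cvec_add)

lemma norm_smult_vec: "norm (c *s x) = cmod c * norm (x :: complex^'n)"
  by (simp add: norm_vec_def norm_mult L2_set_right_distrib)

lemma norm_cvec [simp]: "norm (cvec v) = norm v"
  by (simp add: norm_vec_def cvec_def)

lemma outer_diff_left: "outer (u - v) x = outer u x - outer v x"
  and outer_diff_right: "outer x (u - v) = outer x u - outer x v"
  by (auto simp: outer_def vec_eq_iff algebra_simps)

lemma norm_outer: "norm (outer u v) = norm u * norm v"
proof -
  have "norm (outer u v $ a) = norm (u $ a) * norm v" for a
    by (simp add: outer_def norm_vec_def norm_mult L2_set_right_distrib)
  thus ?thesis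
    by (subst norm_vec_def) (simp add: norm_vec_def[of u] L2_set_left_distrib)
qed

lemma measurable_cvec [measurable]: "cvec \<in> borel_measurable borel"
  unfolding cvec_def by (intro borel_measurable_continuous_onI continuous_intros continuous_on_vec_lambda)

lemma measurable_smult_vec [measurable (raw)]:
  fixes X :: "'a \<Rightarrow> complex^'n"
  assumes "X \<in> borel_measurable N"
  shows "(\<lambda>\<omega>. c *s X \<omega>) \<in> borel_measurable N"
proof (rule measurable_compose[OF assms])
  show "(\<lambda>x :: complex^'n. c *s x) \<in> borel_measurable borel"
    unfolding vector_scalar_mult_def
    by (intro borel_measurable_continuous_onI continuous_intros continuous_on_vec_lambda)
qed

lemma measurable_outer [measurable (raw)]:
  assumes "X \<in> borel_measurable N" "Y \<in> borel_measurable N"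
  shows "(\<lambda>\<omega>. outer (X \<omega>) (Y \<omega>)) \<in> borel_measurable N"
  unfolding outer_def
  by (rule borel_measurable_continuous_Pair[OF assms, where H = "\<lambda>u v. \<chi> a b. u $ a * cnj (v $ b)"])
     (intro continuous_intros continuous_on_vec_lambda)

section \<open>Scalar sums and the overlap of blocks\<close>

lemma sum_inverse_sqrt_le: "(\<Sum>j=1..k. 1 / sqrt (real j)) \<le> 2 * sqrt (real k)"
proof (induction k)
  case (Suc k)
  define a b where "a = sqrt (real k)" and "b = sqrt (real (Suc k))"
  have a: "0 \<le> a" "0 < b" "a \<le> b" "b * b = a * a + 1" by (auto simp: a_def b_def)
  \<comment> \<open>With \<open>b * b = a * a + 1\<close> this square says that \<open>1 / b\<close>
    is at most the increment \<open>2 * (b - a)\<close> of the right side.\<close>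
  have "0 \<le> (b - a) * (b - a)" by simp
  hence "1 \<le> 2 * (b - a) * b" using a by (simp add: algebra_simps)
  hence "1 / b \<le> 2 * (b - a)" using a by (simp add: pos_divide_le_eq)
  moreover have "(\<Sum>j=1..k. 1 / sqrt (real j)) \<le> 2 * a" using Suc by (simp add: a_def)
  ultimately have "(\<Sum>j=1..k. 1 / sqrt (real j)) + 1 / b \<le> 2 * a + 2 * (b - a)" by (rule add_mono[rotated])
  thus ?case by (simp add: b_def)
qed simp

text \<open>Dividing \<open>i * K \<le> t\<close> and \<open>t \<le> m - 1 + i * K\<close> by
  \<open>K\<close> confines \<open>i\<close> to \<open>(m - 1) div K + 1\<close> consecutive
  integers ending at \<open>t div K\<close>, or fewer near 0.\<close>

lemma card_overlapping_blocks:
  fixes K m t :: nat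
  assumes K: "1 \<le> K"
  shows "finite {i. i * K \<le> t \<and> t < i * K + m}"
    and "card {i. i * K \<le> t \<and> t < i * K + m} \<le> (m - 1) div K + 1"
proof -
  let ?N = "(m - 1) div K"
  have sub: "{i. i * K \<le> t \<and> t < i * K + m} \<subseteq> {t div K - ?N..t div K}"
  proof
    fix i assume "i \<in> {i. i * K \<le> t \<and> t < i * K + m}"
    hence i: "i * K \<le> t" "t \<le> m - 1 + i * K" by auto
    have "i \<le> t div K" using div_le_mono[OF i(1), of K] K by simp
    moreover have "t div K \<le> ?N + i" using div_le_mono[OF i(2), of K] K by simp
    ultimately show "i \<in> {t div K - ?N..t div K}" by auto
  qed
  show "finite {i. i * K \<le> t \<and> t < i * K + m}" by (rule finite_subset[OF sub]) simp
  have "card {i. i * K \<le> t \<and> t < i * K + m} \<le> card {t div K - ?N..t div K}"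
    by (rule card_mono[OF _ sub]) simp
  thus "card {i. i * K \<le> t \<and> t < i * K + m} \<le> ?N + 1" by simp
qed

text \<open>Double counting: time \<open>t\<close> occurs once for each block containing it. It is
  applied to the process, to the constant 1 and to the mixing coefficients.\<close>

lemma sum_overlapping_blocks:
  fixes g :: "nat \<Rightarrow> 'b::real_vector"
  shows "(\<Sum>i<j. \<Sum>k<m. g (i * K + k))
    = (\<Sum>t<j * K + m. real (card {i. i < j \<and> i * K \<le> t \<and> t < i * K + m}) *\<^sub>R g t)"
proof -
  have "(\<Sum>k<m. g (i * K + k)) = (\<Sum>t<j * K + m. if i * K \<le> t \<and> t < i * K + m then g t else 0)"
    if "i < j" for i
  proof -
    have le: "i * K \<le> j * K" using that by simp
    hence eq: "{t\<in>{..<j * K + m}. i * K \<le> t \<and> t < i * K + m} = {i * K..<i * K + m}"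
    proof (intro set_eqI)
      fix x show "x \<in> {t\<in>{..<j * K + m}. i * K \<le> t \<and> t < i * K + m} \<longleftrightarrow> x \<in> {i * K..<i * K + m}"
        unfolding mem_Collect_eq atLeastLessThan_iff lessThan_iff using le by linarith
    qed
    have "(\<Sum>k<m. g (i * K + k)) = (\<Sum>t\<in>{i * K..<i * K + m}. g t)"
      by (rule sum.reindex_bij_witness[of _ "\<lambda>t. t - i * K" "\<lambda>k. i * K + k"]) auto
    thus ?thesis by (subst sum.inter_filter[symmetric]) (simp_all only: eq finite_lessThan)
  qed
  hence "(\<Sum>i<j. \<Sum>k<m. g (i * K + k))
     = (\<Sum>i<j. \<Sum>t<j * K + m. if i * K \<le> t \<and> t < i * K + m then g t else 0)" by simp
  also have "\<dots> = (\<Sum>t<j * K + m. \<Sum>i<j. if i * K \<le> t \<and> t < i * K + m then g t else 0)"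
    by (rule sum.swap)
  also have "\<dots> = (\<Sum>t<j * K + m. real (card {i. i < j \<and> i * K \<le> t \<and> t < i * K + m}) *\<^sub>R g t)"
  proof (rule sum.cong[OF refl])
    fix t
    have "(\<Sum>i<j. if i * K \<le> t \<and> t < i * K + m then g t else 0) = (\<Sum>i\<in>{i\<in>{..<j}. i * K \<le> t \<and> t < i * K + m}. g t)"
      by (rule sum.inter_filter[symmetric]) simp
    thus "(\<Sum>i<j. if i * K \<le> t \<and> t < i * K + m then g t else 0)
       = real (card {i. i < j \<and> i * K \<le> t \<and> t < i * K + m}) *\<^sub>R g t"
      by (simp add: sum_constant_scaleR)
  qed
  finally show ?thesis .
qed

section \<open>Stationary mixing processes and their weighted sums\<close>

locale stationary_L_mixing = prob_space M for M :: "'a measure" +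
  fixes F Fp :: "nat \<Rightarrow> 'a measure" and y :: "nat \<Rightarrow> 'a \<Rightarrow> real^'n"
  assumes filtration: "filtration_pair M F Fp" and stationary: "stationary M y" and mixing: "L_mixing M F Fp y"
begin

definition "\<mu> = expectation (y 0)"

abbreviation "mom p \<equiv> enn2real (Mq M p y)"
abbreviation "gam p \<tau> \<equiv> enn2real (gamma_q M Fp p \<tau> y)"
abbreviation "Gam p \<equiv> enn2real (Gamma_d M Fp p y)"
abbreviation "yc i k \<equiv> vcond_exp M (Fp i) (y k)"

lemma sub_F: "subalgebra M (F k)" and sub_Fp: "subalgebra M (Fp k)"
  and F_mono: "k \<le> l \<Longrightarrow> sets (F k) \<subseteq> sets (F l)"
  and F_indep: "indep_set (sets (F k)) (sets (Fp k))"
  using filtration unfolding filtration_pair_def by auto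

lemma y_F: "k \<le> l \<Longrightarrow> y k \<in> borel_measurable (F l)"
proof -
  assume "k \<le> l"
  moreover have "y k \<in> borel_measurable (F k)" using mixing by (simp add: L_mixing_def)
  ultimately show ?thesis using sub_F[of k] sub_F[of l] F_mono[of k l]
    unfolding subalgebra_def by (auto simp: measurable_def)
qed

lemma y_measurable [measurable]: "y k \<in> borel_measurable M"
  using y_F[of k k] sub_F measurable_from_subalg by blast

lemma Lp_y: "1 \<le> p \<Longrightarrow> Lp_le M p (y k) (mom p)"
  using mixing by (intro Lq_norm_finite_Lp_le) (auto simp: L_mixing_def Mq_def intro: SUP_upper)

lemma yc_measurable: "yc i k \<in> borel_measurable (Fp i)"
proof -
  have "(\<lambda>\<omega>. yc i k \<omega> \<bullet> axis j 1) \<in> borel_measurable (Fp i)" for j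
    by (simp add: inner_axis vcond_exp_def)
  thus ?thesis by (subst borel_measurable_euclidean_space) (auto simp: Basis_vec_def)
qed

lemma yc_measurable_M [measurable]: "yc i k \<in> borel_measurable M"
  using yc_measurable sub_Fp measurable_from_subalg by blast

lemma gamma_le: "gamma_q M Fp p \<tau> y \<le> Gamma_d M Fp p y"
  and gamma_finite: "1 \<le> p \<Longrightarrow> gamma_q M Fp p \<tau> y < \<infinity>"
proof -
  show *: "gamma_q M Fp p \<tau> y \<le> Gamma_d M Fp p y"
    unfolding Gamma_d_def using sum_le_suminf[of "\<lambda>\<tau>. gamma_q M Fp p \<tau> y" "{\<tau>}"] by simp
  show "gamma_q M Fp p \<tau> y < \<infinity>" if "1 \<le> p"
    using mixing that * by (auto simp: L_mixing_def intro: le_less_trans)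
qed

lemma Lp_y_diff_yc: "1 \<le> p \<Longrightarrow> i \<le> k \<Longrightarrow> Lp_le M p (\<lambda>\<omega>. y k \<omega> - yc i k \<omega>) (gam p (k - i))"
proof (rule Lq_norm_finite_Lp_le)
  assume "i \<le> k"
  have "Lq_norm M p (\<lambda>\<omega>. y k \<omega> - yc (k - (k - i)) k \<omega>) \<le> gamma_q M Fp p (k - i) y"
    unfolding gamma_q_def by (rule SUP_upper) simp
  thus "Lq_norm M p (\<lambda>\<omega>. y k \<omega> - yc i k \<omega>) \<le> gamma_q M Fp p (k - i) y" using \<open>i \<le> k\<close> by simp
qed (auto simp: gamma_finite[unfolded infinity_ennreal_def])

lemma sum_gam_le: "1 \<le> p \<Longrightarrow> finite A \<Longrightarrow> (\<Sum>\<tau>\<in>A. gam p \<tau>) \<le> Gam p"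
proof -
  assume p: "1 \<le> p" and A: "finite A"
  have fin: "Gamma_d M Fp p y < \<infinity>" using mixing p by (simp add: L_mixing_def)
  have "ennreal (\<Sum>\<tau>\<in>A. gam p \<tau>) = (\<Sum>\<tau>\<in>A. gamma_q M Fp p \<tau> y)"
    using gamma_finite[OF p] by (subst sum_ennreal[symmetric]) auto
  also have "\<dots> \<le> Gamma_d M Fp p y" unfolding Gamma_d_def using A by (intro sum_le_suminf) auto
  also have "\<dots> = ennreal (Gam p)" using fin by simp
  finally show ?thesis by simp
qed

lemma y_integrable: "integrable M (y k)"
  using Lp_le_expectation(1)[OF Lp_y[of 1]] by simp

lemma yc_integrable: "i \<le> k \<Longrightarrow> integrable M (yc i k)"
  using Bochner_Integration.integrable_diff[OF y_integrable[of k] Lp_le_expectation(1)[OF Lp_y_diff_yc[of 1 i k]]] by simp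

text \<open>The tower property, taken coordinate by coordinate because \<open>vcond_exp\<close> is
  defined that way.\<close>

lemma expectation_yc: "i \<le> k \<Longrightarrow> expectation (yc i k) = expectation (y k)"
proof (subst vec_eq_iff, intro allI)
  fix j assume i: "i \<le> k"
  interpret sigma_finite_subalgebra M "Fp i"
    using sub_Fp finite_measure_axioms
    by (intro finite_measure_subalgebra_is_sigma_finite) (simp add: finite_measure_subalgebra_def finite_measure_subalgebra_axioms_def)
  have nth: "(expectation X) $ j = expectation (\<lambda>\<omega>. X \<omega> $ j)" if "integrable M X" for X :: "'a \<Rightarrow> real^'n"
    using integral_bounded_linear[OF bounded_linear_vec_nth that] by simp
  have "integrable M (\<lambda>\<omega>. y k \<omega> $ j)"
    by (rule integrable_bounded_linear[OF bounded_linear_vec_nth y_integrable])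
  thus "expectation (yc i k) $ j = expectation (y k) $ j"
    using nth[OF y_integrable] nth[OF yc_integrable[OF i]] real_cond_exp_int(2) by (simp add: vcond_exp_def)
qed

text \<open>Stationarity equates laws on path space, so it passes to any measurable functional of
  the path by change of variables. Outer products depend jointly on a whole block and need this
  form.\<close>

lemma expectation_shift:
  fixes g :: "(nat \<Rightarrow> real^'n) \<Rightarrow> 'c::{banach,second_countable_topology}"
  assumes [measurable]: "g \<in> borel_measurable (Pi\<^sub>M UNIV (\<lambda>_. borel))"
  shows "expectation (\<lambda>\<omega>. g (\<lambda>t. y (t + k) \<omega>)) = expectation (\<lambda>\<omega>. g (\<lambda>t. y t \<omega>))"
proof -
  have "expectation (\<lambda>\<omega>. g (\<lambda>t. y (t + l) \<omega>)) = (\<integral>x. g x \<partial>distr M (Pi\<^sub>M UNIV (\<lambda>_. borel)) (\<lambda>\<omega> t. y (t + l) \<omega>))" for l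
    by (rule integral_distr[symmetric]) (auto intro!: measurable_PiM_single')
  from this[of k] this[of 0] show ?thesis using stationary by (simp add: stationary_def)
qed

lemma expectation_y: "expectation (y k) = \<mu>"
  using expectation_shift[of "\<lambda>x. x 0" k] by (simp add: \<mu>_def)

lemma c1_nonneg: "1 \<le> Q \<Longrightarrow> 0 \<le> c1 M Fp y Q"
  by (simp add: c1_def)

text \<open>The moment inequality with scales \<open>cmod (c k)\<close>. Centring doubles the moment
  to \<open>2 * mom p\<close>, the errors are \<open>gam p\<close>, and the starting time
  \<open>t\<close> shifts both families of sigma-algebras.\<close>

lemma Lp_weighted_sum:
  fixes c :: "nat \<Rightarrow> complex"
  assumes Q: "1 \<le> Q"
  shows "Lp_le M (2 * Q) (\<lambda>\<omega>. \<Sum>k<n. c k *s cvec (y (t + k) \<omega> - \<mu>))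
    (c1 M Fp y Q * sqrt (\<Sum>k<n. (cmod (c k))\<^sup>2))"
proof -
  define p where "p = 2 * Q"
  have p: "2 \<le> p" "1 \<le> p" using Q by (auto simp: p_def)
  let ?U = "\<lambda>k \<omega>. c k *s cvec (y (t + k) \<omega> - \<mu>)"
  let ?V = "\<lambda>i k \<omega>. c k *s cvec (yc (t + i) (t + k) \<omega> - \<mu>)"
  have lin: "bounded_linear (\<lambda>v :: real^'n. d *s cvec v)" for d
    by (rule bounded_linear_intro[where K = "cmod d"])
      (simp_all add: norm_smult_vec mult.commute, simp_all add: cvec_def vec_eq_iff scaleR_conv_of_real[where 'a=complex] algebra_simps)
  have "Lp_le M p (\<lambda>\<omega>. \<Sum>k<n. ?U k \<omega>) (2 * sqrt ((p - 1) * (2 * mom p) * Gam p * (\<Sum>k<n. (cmod (c k))\<^sup>2)))"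
  proof (rule L_mixing_sum_bound[where F = "\<lambda>i. F (t + i)" and G = "\<lambda>i. Fp (t + i)" and V = ?V and g = "gam p"])
    show "expectation (?V i k) = 0" if "i \<le> k" for i k
    proof -
      have "expectation (?V i k) = c k *s cvec (expectation (\<lambda>\<omega>. yc (t + i) (t + k) \<omega> - \<mu>))"
        using yc_integrable[of "t + i" "t + k"] that by (intro integral_bounded_linear[OF lin]) auto
      also have "expectation (\<lambda>\<omega>. yc (t + i) (t + k) \<omega> - \<mu>) = 0"
        using yc_integrable[of "t + i" "t + k"] that by (simp add: expectation_yc expectation_y prob_space)
      finally show ?thesis by simp
    qed
    show "Lp_le M p (?U k) (cmod (c k) * (2 * mom p))" for k
      by (rule Lp_le_scale[where X = "\<lambda>\<omega>. y (t + k) \<omega> - \<mu>"])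
        (use Lp_le_center[OF Lp_y[OF p(2)] p(2), of "t + k"] p in \<open>auto simp: expectation_y norm_smult_vec\<close>)
    show "Lp_le M p (\<lambda>\<omega>. ?U k \<omega> - ?V i k \<omega>) (cmod (c k) * gam p (k - i))" if "i \<le> k" for i k
    proof -
      have "?U k \<omega> - ?V i k \<omega> = c k *s cvec (y (t + k) \<omega> - yc (t + i) (t + k) \<omega>)" for \<omega>
        by (simp add: cvec_diff vec_eq_iff algebra_simps)
      moreover have "Lp_le M p (\<lambda>\<omega>. c k *s cvec (y (t + k) \<omega> - yc (t + i) (t + k) \<omega>)) (cmod (c k) * gam p (k - i))"
        by (rule Lp_le_scale[where X = "\<lambda>\<omega>. y (t + k) \<omega> - yc (t + i) (t + k) \<omega>"])
          (use Lp_y_diff_yc[OF p(2), of "t + i" "t + k"] that p in \<open>auto simp: norm_smult_vec\<close>)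
      ultimately show ?thesis by simp
    qed
    show "?U k \<in> borel_measurable (F (t + k))" for k
      using y_F[of "t + k" "t + k"] by measurable
    show "?V i k \<in> borel_measurable (Fp (t + i))" for i k
      using yc_measurable[of "t + i" "t + k"] by measurable
  qed (use p sub_F sub_Fp F_mono F_indep sum_gam_le in auto)
  moreover have "2 * sqrt ((p - 1) * (2 * mom p) * Gam p * (\<Sum>k<n. (cmod (c k))\<^sup>2))
     \<le> c1 M Fp y Q * sqrt (\<Sum>k<n. (cmod (c k))\<^sup>2)"
  proof -
    \<comment> \<open>The inequality yields \<open>2 * sqrt (2 * A)\<close>, at most the
      \<open>4 * sqrt A\<close> contained in \<open>c1\<close>.\<close>
    define A where "A = (p - 1) * mom p * Gam p * (\<Sum>k<n. (cmod (c k))\<^sup>2)"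
    have A: "0 \<le> A" unfolding A_def using p by (intro mult_nonneg_nonneg sum_nonneg) auto
    have "sqrt (2 * A) \<le> sqrt (4 * A)" using A by simp
    also have "sqrt (4 * A) = 2 * sqrt A" by (simp add: real_sqrt_mult)
    finally have "2 * sqrt (2 * A) \<le> 4 * sqrt A" by simp
    moreover have "(p - 1) * (2 * mom p) * Gam p * (\<Sum>k<n. (cmod (c k))\<^sup>2) = 2 * A" by (simp add: A_def)
    moreover have "c1 M Fp y Q * sqrt (\<Sum>k<n. (cmod (c k))\<^sup>2) = 4 * sqrt A"
      unfolding c1_def A_def p_def by (simp add: real_sqrt_mult)
    ultimately show ?thesis by (simp only:)
  qed
  ultimately show ?thesis using p unfolding p_def by (auto intro: Lp_le_weaken)
qed

end

section \<open>Windowed transforms at one fixed frequency\<close>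

locale spectral_estimator = stationary_L_mixing M F Fp y
  for M :: "'a measure" and F Fp :: "nat \<Rightarrow> 'a measure" and y :: "nat \<Rightarrow> 'a \<Rightarrow> real^'n" +
  fixes K Mb :: nat and c :: "nat \<Rightarrow> complex"
  assumes K: "1 \<le> K" and KM: "K \<le> Mb" and c_norm: "(\<Sum>k<Mb. (cmod (c k))\<^sup>2) = 1"
begin

definition "N = real ((Mb - 1) div K + 1)"

definition "H = (\<Sum>k<Mb. c k)"

definition "D j \<omega> = (\<Sum>k<Mb. c k *s cvec (y (j * K + k) \<omega> - \<mu>))"

definition "Phi = expectation (\<lambda>\<omega>. outer (D 0 \<omega>) (D 0 \<omega>))"

lemma N_ge_1: "1 \<le> N"
  by (simp add: N_def)

lemma Mb_pos: "0 < Mb"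
  using K KM by simp

text \<open>Cauchy-Schwarz with unit-norm weights. The factor \<open>Mb\<close> later cancels the
  \<open>1 / Mb\<close> of the block means.\<close>

lemma cmod_H_le: "(cmod H)\<^sup>2 \<le> real Mb"
proof -
  have "(cmod H)\<^sup>2 \<le> (\<Sum>k<Mb. 1 * cmod (c k))\<^sup>2"
    unfolding H_def by (intro power_mono) (auto intro: norm_sum)
  also have "\<dots> \<le> (\<Sum>k<Mb. 1\<^sup>2) * (\<Sum>k<Mb. (cmod (c k))\<^sup>2)"
    by (rule Cauchy_Schwarz_ineq_sum)
  finally show ?thesis by (simp add: c_norm)
qed

lemma cmod_c_le_1: "k < Mb \<Longrightarrow> cmod (c k) \<le> 1"
proof -
  assume "k < Mb"
  hence "(cmod (c k))\<^sup>2 \<le> (\<Sum>k<Mb. (cmod (c k))\<^sup>2)" by (intro member_le_sum) auto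
  thus ?thesis unfolding c_norm by (simp add: power_le_one_iff)
qed

lemma D_measurable [measurable]: "D j \<in> borel_measurable M"
  unfolding D_def by measurable

lemma Lp_D: "1 \<le> Q \<Longrightarrow> Lp_le M (2 * Q) (D j) (c1 M Fp y Q)"
  using Lp_weighted_sum[where n = Mb and c = c and t = "j * K"] by (simp add: c_norm D_def[abs_def])

lemma card_blocks_le: "real (card {i. i < j \<and> i * K \<le> t \<and> t < i * K + Mb}) \<le> N"
proof -
  have "card {i. i < j \<and> i * K \<le> t \<and> t < i * K + Mb} \<le> card {i. i * K \<le> t \<and> t < i * K + Mb}"
    by (rule card_mono[OF card_overlapping_blocks(1)[OF K]]) auto
  thus ?thesis using card_overlapping_blocks(2)[OF K, of t Mb] unfolding N_def by linarith
qed

text \<open>The running mean averages single times with weights \<open>f t\<close>. These sum to 1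
  and none exceeds \<open>N / (j * Mb)\<close>, so their squares sum to at most that; multiplying by
  \<open>(cmod H)\<^sup>2 \<le> Mb\<close> leaves \<open>N / j\<close>.\<close>

lemma Lp_mean_error:
  assumes Q: "1 \<le> Q" and j: "1 \<le> j"
  shows "Lp_le M (2 * Q) (\<lambda>\<omega>. H *s cvec ((1 / real j) *\<^sub>R (\<Sum>i<j. ybar K Mb y i \<omega>) - \<mu>))
    (c1 M Fp y Q * sqrt (N / real j))"
proof -
  define r where "r t = real (card {i. i < j \<and> i * K \<le> t \<and> t < i * K + Mb})" for t
  define f where "f t = r t / (real j * real Mb)" for t
  define T where "T = j * K + Mb"
  have JM: "0 < real j * real Mb" using j Mb_pos by simp
  have rsum: "(\<Sum>t<T. r t) = real j * real Mb"
    \<comment> \<open>The counting identity for the constant function 1.\<close>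
    using sum_overlapping_blocks[where g = "\<lambda>_. 1 :: real" and j = j and K = K and m = Mb]
    by (simp add: r_def T_def)
  have fsum: "(\<Sum>t<T. f t) = 1"
    using JM unfolding f_def sum_divide_distrib[symmetric] rsum by (rule divide_self[OF less_imp_neq[symmetric]])
  have eq: "(1 / real j) *\<^sub>R (\<Sum>i<j. ybar K Mb y i \<omega>) - \<mu> = (\<Sum>t<T. f t *\<^sub>R (y t \<omega> - \<mu>))" for \<omega>
  proof -
    have "(\<Sum>i<j. ybar K Mb y i \<omega>) = (1 / real Mb) *\<^sub>R (\<Sum>t<T. r t *\<^sub>R y t \<omega>)"
      unfolding ybar_def scaleR_sum_right[symmetric] r_def T_def by (subst sum_overlapping_blocks) simp
    hence "(1 / real j) *\<^sub>R (\<Sum>i<j. ybar K Mb y i \<omega>) = (\<Sum>t<T. f t *\<^sub>R y t \<omega>)"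
      by (simp add: f_def scaleR_sum_right mult_ac)
    moreover have "\<mu> = (\<Sum>t<T. f t *\<^sub>R \<mu>)" using fsum by (simp flip: scaleR_sum_left)
    ultimately show ?thesis by (simp add: scaleR_diff_right sum_subtractf)
  qed
  have "H *s cvec ((1 / real j) *\<^sub>R (\<Sum>i<j. ybar K Mb y i \<omega>) - \<mu>)
     = (\<Sum>t<T. (H * of_real (f t)) *s cvec (y (0 + t) \<omega> - \<mu>))" for \<omega>
    unfolding eq by (simp add: cvec_sum cvec_scaleR vec_eq_iff sum_distrib_left mult_ac)
  moreover have "(\<Sum>t<T. (cmod (H * of_real (f t)))\<^sup>2) \<le> N / real j"
  proof -
    have "(\<Sum>t<T. (f t)\<^sup>2) \<le> (\<Sum>t<T. (N / (real j * real Mb)) * f t)"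
      using card_blocks_le JM unfolding power2_eq_square f_def r_def
      by (intro sum_mono mult_right_mono divide_right_mono) auto
    also have "\<dots> = N / (real j * real Mb)" unfolding sum_distrib_left[symmetric] fsum by simp
    finally have f2: "(\<Sum>t<T. (f t)\<^sup>2) \<le> N / (real j * real Mb)" .
    have "(\<Sum>t<T. (cmod (H * of_real (f t)))\<^sup>2) = (cmod H)\<^sup>2 * (\<Sum>t<T. (f t)\<^sup>2)"
      by (simp add: norm_mult power_mult_distrib sum_distrib_left)
    also have "\<dots> \<le> real Mb * (N / (real j * real Mb))"
      using cmod_H_le f2 by (intro mult_mono) (auto intro: sum_nonneg)
    also have "\<dots> = N / real j" using Mb_pos by simp
    finally show ?thesis .
  qed
  hence "c1 M Fp y Q * sqrt (\<Sum>t<T. (cmod (H * of_real (f t)))\<^sup>2) \<le> c1 M Fp y Q * sqrt (N / real j)"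
    using c1_nonneg[OF Q] by (intro mult_left_mono) auto
  ultimately show ?thesis
    using Lp_le_weaken[OF Lp_weighted_sum[OF Q, where n = T and c = "\<lambda>t. H * of_real (f t)" and t = 0]] Q by simp
qed

lemma expectation_outer_D: "expectation (\<lambda>\<omega>. outer (D j \<omega>) (D j \<omega>)) = Phi"
proof -
  let ?S = "\<lambda>x :: nat \<Rightarrow> real^'n. \<Sum>k<Mb. c k *s cvec (x k - \<mu>)"
  have [measurable]: "?S \<in> borel_measurable (Pi\<^sub>M UNIV (\<lambda>_. borel))" by measurable
  show ?thesis
    using expectation_shift[of "\<lambda>x. outer (?S x) (?S x)" "j * K"]
    by (simp add: Phi_def D_def add.commute)
qed

lemma Lp_outer:
  assumes "1 \<le> q" "Lp_le M (2 * (2 * q)) X a" "Lp_le M (2 * (2 * q)) Z b"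
  shows "Lp_le M (2 * q) (\<lambda>\<omega>. outer (X \<omega>) (Z \<omega>)) (a * b)"
  by (rule Lp_le_mult[OF assms(2,3)])
     (use assms Lp_le_measurable[OF assms(2)] Lp_le_measurable[OF assms(3)] in \<open>auto simp: norm_outer\<close>)

text \<open>In the moment inequality \<open>2 * C\<^sup>2\<close> is the norm of a centred outer
  product and \<open>6 * C * c2\<close> bounds the summed approximation errors. Exponent
  \<open>2 * q\<close> for products requires \<open>4 * q\<close> for the factors.\<close>

lemma Lp_outer_D_sum:
  assumes q: "1 \<le> q"
  defines "C \<equiv> c1 M Fp y (2 * q)"
  shows "Lp_le M (2 * q) (\<lambda>\<omega>. \<Sum>j<k. outer (D j \<omega>) (D j \<omega>) - Phi)
    (2 * sqrt ((2 * q - 1) * (2 * C\<^sup>2) * (6 * C * c2 M Fp K Mb y (2 * q)) * real k))"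
proof -
  define p where "p = 2 * (2 * q)"
  have p: "1 \<le> p" "1 \<le> 2 * q" using q by (auto simp: p_def)
  have C: "0 \<le> C" using c1_nonneg[of "2 * q"] q by (simp add: C_def)
  \<comment> \<open>The last time of block \<open>i\<close>, so that \<open>D i\<close> is
    measurable for \<open>F (L i)\<close>.\<close>
  define L where "L i = i * K + Mb - 1" for i
  \<comment> \<open>\<open>\<tau> * K + l + 1 - Mb\<close> is the lag from \<open>L i\<close> to the
    \<open>l\<close>-th time of block \<open>i + \<tau>\<close>. For
    \<open>\<tau> * K < Mb - 1\<close> that block starts before \<open>L i\<close>, and a constant
    is used.\<close>
  define \<delta> where "\<delta> \<tau> = (if \<tau> * K < Mb - 1 then 2 * C else \<Sum>l<Mb. gam p (\<tau> * K + l + 1 - Mb))" for \<tau>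
  define E where "E i j \<omega> = (\<Sum>k<Mb. c k *s cvec (yc (L i) (j * K + k) \<omega> - \<mu>))" for i j \<omega>
  \<comment> \<open>Outside \<open>P\<close> the zero approximant is good enough, since there \<open>C \<le> \<delta> \<tau>\<close>; inside \<open>P\<close> the norm
    of \<open>E i j\<close> is controlled by that of \<open>D j\<close> without a contraction property of conditional
    expectation.\<close>
  define P where "P \<tau> \<longleftrightarrow> Mb - 1 \<le> \<tau> * K \<and> \<delta> \<tau> \<le> C" for \<tau>
  let ?U = "\<lambda>j \<omega>. outer (D j \<omega>) (D j \<omega>) - Phi"
  define V where "V = (\<lambda>i j \<omega>. if P (j - i) then outer (E i j \<omega>) (E i j \<omega>)
      - expectation (\<lambda>\<omega>. outer (E i j \<omega>) (E i j \<omega>)) else 0)"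
  have \<delta>0: "0 \<le> \<delta> \<tau>" for \<tau> using C by (auto simp: \<delta>_def intro!: sum_nonneg)
  have DL: "Lp_le M p (D j) C" for j
    using Lp_D[of "2 * q" j] q by (simp add: p_def C_def)
  have outer_DL: "Lp_le M (2 * q) (\<lambda>\<omega>. outer (D j \<omega>) (D j \<omega>)) (C\<^sup>2)" for j
    using Lp_outer[OF q DL[of j, unfolded p_def] DL[of j, unfolded p_def]] by (simp add: power2_eq_square)
  have UL: "Lp_le M (2 * q) (?U j) (2 * C\<^sup>2)" for j
    using Lp_le_center[OF outer_DL p(2)] by (simp add: expectation_outer_D)
  have EG: "E i j \<in> borel_measurable (Fp (L i))" for i j
    unfolding E_def by (intro borel_measurable_sum measurable_smult_vec measurable_compose[OF _ measurable_cvec]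
        borel_measurable_diff yc_measurable) simp
  have EM [measurable]: "E i j \<in> borel_measurable M" for i j
    using EG sub_Fp measurable_from_subalg by blast
  have DE: "Lp_le M p (\<lambda>\<omega>. D j \<omega> - E i j \<omega>) (\<delta> (j - i))" if ij: "i \<le> j" and lag: "Mb - 1 \<le> (j - i) * K" for i j
  proof -
    obtain \<tau> where \<tau>: "j = i + \<tau>" using ij by (auto simp: le_iff_add)
    have lag': "Mb - 1 \<le> \<tau> * K" using lag \<tau> by simp
    have le: "L i \<le> j * K + k" and sub: "j * K + k - L i = \<tau> * K + k + 1 - Mb" for k
      using lag' Mb_pos unfolding L_def \<tau> add_mult_distrib by linarith+
    have "Lp_le M p (\<lambda>\<omega>. \<Sum>k<Mb. c k *s cvec (y (j * K + k) \<omega> - yc (L i) (j * K + k) \<omega>)) (\<Sum>k<Mb. gam p (\<tau> * K + k + 1 - Mb))"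
    proof (rule Lp_le_sum)
      fix k assume k: "k \<in> {..<Mb}"
      have "Lp_le M p (\<lambda>\<omega>. c k *s cvec (y (j * K + k) \<omega> - yc (L i) (j * K + k) \<omega>)) (1 * gam p (\<tau> * K + k + 1 - Mb))"
      proof (rule Lp_le_scale)
        show "Lp_le M p (\<lambda>\<omega>. y (j * K + k) \<omega> - yc (L i) (j * K + k) \<omega>) (gam p (\<tau> * K + k + 1 - Mb))"
          using Lp_y_diff_yc[OF p(1) le[of k]] by (simp only: sub)
        show "norm (c k *s cvec (y (j * K + k) \<omega> - yc (L i) (j * K + k) \<omega>))
            \<le> 1 * norm (y (j * K + k) \<omega> - yc (L i) (j * K + k) \<omega>)" for \<omega>
          using cmod_c_le_1[of k] k unfolding norm_smult_vec norm_cvec by (intro mult_right_mono) auto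
      qed (measurable, use p in auto)
      thus "Lp_le M p (\<lambda>\<omega>. c k *s cvec (y (j * K + k) \<omega> - yc (L i) (j * K + k) \<omega>)) (gam p (\<tau> * K + k + 1 - Mb))"
        by simp
    qed (use p in auto)
    moreover have "D j \<omega> - E i j \<omega> = (\<Sum>k<Mb. c k *s cvec (y (j * K + k) \<omega> - yc (L i) (j * K + k) \<omega>))" for \<omega>
      unfolding D_def E_def sum_subtractf[symmetric]
      by (intro sum.cong refl) (simp add: cvec_diff vec_eq_iff algebra_simps)
    moreover have "\<delta> (j - i) = (\<Sum>k<Mb. gam p (\<tau> * K + k + 1 - Mb))" using lag' \<tau> by (simp add: \<delta>_def)
    ultimately show ?thesis by simp
  qed
  have EL: "Lp_le M p (E i j) (2 * C)" if "i \<le> j" "P (j - i)" for i j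
  proof -
    have "Lp_le M p (\<lambda>\<omega>. D j \<omega> - (D j \<omega> - E i j \<omega>)) (C + \<delta> (j - i))"
      using that by (intro Lp_le_diff DL DE p) (auto simp: P_def)
    thus ?thesis using that p by (auto simp: P_def intro: Lp_le_weaken)
  qed
  have outer_EL: "Lp_le M (2 * q) (\<lambda>\<omega>. outer (E i j \<omega>) (E i j \<omega>)) ((2 * C) * (2 * C))" if "i \<le> j" "P (j - i)" for i j
    using Lp_outer[OF q EL[OF that, unfolded p_def] EL[OF that, unfolded p_def]] .
  have "Lp_le M (2 * q) (\<lambda>\<omega>. \<Sum>j<k. ?U j \<omega>)
     (2 * sqrt ((2 * q - 1) * (2 * C\<^sup>2) * (6 * C * c2 M Fp K Mb y (2 * q)) * (\<Sum>j<k. 1\<^sup>2)))"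
  proof (rule L_mixing_sum_bound[where F = "\<lambda>i. F (L i)" and G = "\<lambda>i. Fp (L i)" and V = V and g = "\<lambda>\<tau>. 6 * C * \<delta> \<tau>"])
    show "sets (F (L i)) \<subseteq> sets (F (L j))" if "i \<le> j" for i j
      using that by (intro F_mono) (auto simp: L_def intro!: diff_le_mono)
    show "?U j \<in> borel_measurable (F (L j))" for j
    proof -
      have "D j \<in> borel_measurable (F (L j))"
        unfolding D_def L_def
        by (intro borel_measurable_sum measurable_smult_vec measurable_compose[OF _ measurable_cvec]
          borel_measurable_diff y_F) auto
      thus ?thesis by measurable
    qed
    show "V i j \<in> borel_measurable (Fp (L i))" for i j
      unfolding V_def using EG[of i j] by measurable
    show "expectation (V i j) = 0" if "i \<le> j" for i j
    proof (cases "P (j - i)")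
      case True
      have "integrable M (\<lambda>\<omega>. outer (E i j \<omega>) (E i j \<omega>))"
        by (rule Lp_le_expectation(1)[OF outer_EL[OF that True] p(2)])
      thus ?thesis using True by (simp add: V_def prob_space)
    qed (simp add: V_def)
    show "Lp_le M (2 * q) (\<lambda>\<omega>. ?U j \<omega> - V i j \<omega>) (1 * (6 * C * \<delta> (j - i)))" if ij: "i \<le> j" for i j
    proof (cases "P (j - i)")
      case False
      hence "C \<le> \<delta> (j - i)" using C unfolding P_def \<delta>_def by auto
      hence "C * C \<le> C * \<delta> (j - i)" using C by (intro mult_left_mono)
      hence "2 * C\<^sup>2 \<le> 6 * C * \<delta> (j - i)" using mult_nonneg_nonneg[OF C \<delta>0[of "j - i"]] by (simp add: power2_eq_square)
      thus ?thesis using False Lp_le_weaken[OF UL] p by (simp add: V_def)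
    next
      case True
      let ?X = "\<lambda>\<omega>. outer (D j \<omega>) (D j \<omega>) - outer (E i j \<omega>) (E i j \<omega>)"
      have lag: "Mb - 1 \<le> (j - i) * K" using True by (simp add: P_def)
      note DE' = DE[OF ij lag, unfolded p_def]
      \<comment> \<open>One factor is exchanged at a time, giving
        \<open>C * \<delta> + 2 * C * \<delta>\<close>; centring doubles this to the coefficient
        6.\<close>
      have "Lp_le M (2 * q) (\<lambda>\<omega>. outer (D j \<omega>) (D j \<omega> - E i j \<omega>) + outer (D j \<omega> - E i j \<omega>) (E i j \<omega>))
          (C * \<delta> (j - i) + \<delta> (j - i) * (2 * C))"
        by (intro Lp_le_add Lp_outer[OF q] DL[unfolded p_def] DE' EL[OF ij True, unfolded p_def] p)
      hence X: "Lp_le M (2 * q) ?X (3 * C * \<delta> (j - i))"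
        by (simp add: outer_diff_left outer_diff_right algebra_simps)
      have EX: "expectation ?X = Phi - expectation (\<lambda>\<omega>. outer (E i j \<omega>) (E i j \<omega>))"
        using Lp_le_expectation(1)[OF outer_DL p(2), of j] Lp_le_expectation(1)[OF outer_EL[OF ij True] p(2)]
        by (simp add: expectation_outer_D)
      have UV: "?U j \<omega> - V i j \<omega> = ?X \<omega> - expectation ?X" for \<omega>
        unfolding EX using True by (simp add: V_def)
      have "1 * (6 * C * \<delta> (j - i)) = 2 * (3 * C * \<delta> (j - i))" by simp
      thus ?thesis using Lp_le_center[OF X p(2)] by (simp only: UV)
    qed
    show "(\<Sum>\<tau><n. 6 * C * \<delta> \<tau>) \<le> 6 * C * c2 M Fp K Mb y (2 * q)" for n
    proof -
      \<comment> \<open>The coefficients delayed by \<open>Mb - 1\<close> and extended by zero, so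
        that the sum over blocks can be recounted by time with multiplicity at most
        \<open>N\<close>.\<close>
      define gg where "gg t = (if Mb \<le> t + 1 then gam p (t + 1 - Mb) else 0)" for t
      have gg0: "0 \<le> gg t" for t by (simp add: gg_def)
      have "\<delta> \<tau> \<le> (if \<tau> * K < Mb - 1 then 2 * C else 0) + (\<Sum>l<Mb. gg (\<tau> * K + l))" for \<tau>
        using gg0 by (auto simp: \<delta>_def gg_def intro!: sum_nonneg sum_mono)
      hence "(\<Sum>\<tau><n. \<delta> \<tau>) \<le> (\<Sum>\<tau><n. (if \<tau> * K < Mb - 1 then 2 * C else 0) + (\<Sum>l<Mb. gg (\<tau> * K + l)))"
        by (intro sum_mono)
      also have "\<dots> = (\<Sum>\<tau><n. if \<tau> * K < Mb - 1 then 2 * C else 0) + (\<Sum>\<tau><n. \<Sum>l<Mb. gg (\<tau> * K + l))"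
        by (rule sum.distrib)
      also have "(\<Sum>\<tau><n. if \<tau> * K < Mb - 1 then 2 * C else 0) \<le> N * (2 * C)"
      proof -
        \<comment> \<open>The short block lags are among \<open>N\<close> integers, each costing
          \<open>2 * C\<close>.\<close>
        have sub: "{\<tau>\<in>{..<n}. \<tau> * K < Mb - 1} \<subseteq> {..(Mb - 1) div K}"
          using K by (auto simp: less_eq_div_iff_mult_less_eq)
        have "(\<Sum>\<tau><n. if \<tau> * K < Mb - 1 then 2 * C else 0) = (\<Sum>\<tau>\<in>{\<tau>\<in>{..<n}. \<tau> * K < Mb - 1}. 2 * C)"
          by (rule sum.inter_filter[symmetric]) simp
        also have "\<dots> \<le> (\<Sum>\<tau>\<in>{..(Mb - 1) div K}. 2 * C)"
          using C by (intro sum_mono2 sub) auto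
        finally show ?thesis by (simp add: N_def)
      qed
      also have "(\<Sum>\<tau><n. \<Sum>l<Mb. gg (\<tau> * K + l)) \<le> N * Gam p"
      proof -
        have "(\<Sum>\<tau><n. \<Sum>l<Mb. gg (\<tau> * K + l)) \<le> (\<Sum>t<n * K + Mb. N * gg t)"
          unfolding sum_overlapping_blocks[of gg] real_scaleR_def
          using card_blocks_le gg0 by (intro sum_mono mult_right_mono) auto
        also have "\<dots> = N * (\<Sum>t<n * K + Mb. gg t)" by (simp add: sum_distrib_left)
        also have "(\<Sum>t<n * K + Mb. gg t) = (\<Sum>t\<in>{t\<in>{..<n * K + Mb}. Mb \<le> t + 1}. gam p (t + 1 - Mb))"
          unfolding gg_def by (rule sum.inter_filter[symmetric]) simp
        also have "\<dots> = (\<Sum>t\<in>{..n * K}. gam p t)"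
          using Mb_pos by (intro sum.reindex_bij_witness[of _ "\<lambda>t. t + Mb - 1" "\<lambda>t. t + 1 - Mb"]) auto
        also have "\<dots> \<le> Gam p" using p by (intro sum_gam_le) auto
        finally show ?thesis using N_ge_1 by (simp add: mult_left_mono)
      qed
      finally have "(\<Sum>\<tau><n. \<delta> \<tau>) \<le> c2 M Fp K Mb y (2 * q)"
        by (simp add: c2_def C_def N_def p_def algebra_simps)
      thus ?thesis unfolding sum_distrib_left[symmetric] using C by (intro mult_left_mono) auto
    qed
  qed (use q sub_F sub_Fp F_indep C \<delta>0 UL in auto)
  thus ?thesis by simp
qed

end

text \<open>With step \<open>1 / (j + 1)\<close> the quantity \<open>k * x k\<close> grows by
  exactly \<open>z k\<close>. At \<open>k = 0\<close> the factor vanishes, so the initial value is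
  forgotten.\<close>

lemma running_average:
  fixes x z :: "nat \<Rightarrow> 'b::real_vector"
  assumes "\<And>j. x (Suc j) = x j + (1 / real (j + 1)) *\<^sub>R (z j - x j)"
  shows "real k *\<^sub>R x k = (\<Sum>j<k. z j)"
proof (induction k)
  case (Suc k)
  have "real (Suc k) *\<^sub>R x (Suc k) = real (Suc k) *\<^sub>R x k + (z k - x k)"
    by (subst assms) (simp add: scaleR_add_right)
  also have "\<dots> = real k *\<^sub>R x k + z k" by (simp add: algebra_simps)
  finally show ?case using Suc by simp
qed simp

section \<open>Error of the online estimator\<close>

context spectral_estimator
begin

text \<open>Expanding the outer product of \<open>D j - e j\<close> separates the fluctuation of the
  outer products of \<open>D j\<close> from terms containing the mean error. The work is done in
  exponent \<open>2 * q\<close>, as the moment inequality needs at least 2, and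
  \<open>Lp_le_halve\<close> descends to \<open>q\<close>.\<close>

lemma Lp_covariance_error:
  fixes muh :: "nat \<Rightarrow> 'a \<Rightarrow> real^'n" and Phih :: "nat \<Rightarrow> 'a \<Rightarrow> complex^'n^'n"
  assumes muh0: "\<And>\<omega>. muh 0 \<omega> = 0"
    and muh: "\<And>j \<omega>. muh (Suc j) \<omega> = muh j \<omega> + (1 / real (j + 1)) *\<^sub>R (ybar K Mb y j \<omega> - muh j \<omega>)"
    and Phih: "\<And>j \<omega>. Phih (Suc j) \<omega> = Phih j \<omega> + (1 / real (j + 1)) *\<^sub>R
      (outer (D j \<omega> - H *s cvec (muh j \<omega> - \<mu>)) (D j \<omega> - H *s cvec (muh j \<omega> - \<mu>)) - Phih j \<omega>)"
    and k: "1 \<le> k" and q: "1 \<le> q"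
  shows "Lp_le M q (\<lambda>\<omega>. Phih k \<omega> - Phi)
    (bq M Fp K Mb y q * (1 / sqrt (real k))
      + ((mom (4 * q))\<^sup>2 + 2 * c1 M Fp y (2 * q) * mom (4 * q)) * (real Mb / real k))"
proof -
  define p where "p = 2 * (2 * q)"
  have p: "1 \<le> p" "1 \<le> 2 * q" using q by (auto simp: p_def)
  define C where "C = c1 M Fp y (2 * q)"
  define m where "m = mom (4 * q)"
  define A where "A = (2 * q - 1) * (2 * C\<^sup>2) * (6 * C * c2 M Fp K Mb y (2 * q))"
  define e where "e j \<omega> = H *s cvec (muh j \<omega> - \<mu>)" for j \<omega>
  \<comment> \<open>At index 0 the mean estimate is 0, so the error is the constant
    \<open>H *s cvec (- \<mu>)\<close>. It is the source of the \<open>Mb / k\<close> term.\<close>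
  define \<epsilon> where "\<epsilon> j = (if j = 0 then sqrt (real Mb) * m else C * sqrt (N / real j))" for j
  have C: "0 \<le> C" using c1_nonneg[of "2 * q"] q by (simp add: C_def)
  have m: "0 \<le> m" by (simp add: m_def)
  have H: "cmod H \<le> sqrt (real Mb)" using cmod_H_le by (rule real_le_rsqrt)
  have muh_avg: "muh j \<omega> = (1 / real j) *\<^sub>R (\<Sum>i<j. ybar K Mb y i \<omega>)" if "1 \<le> j" for j \<omega>
    unfolding running_average[of "\<lambda>j. muh j \<omega>" "\<lambda>j. ybar K Mb y j \<omega>", OF muh, symmetric]
    using that by simp
  have eL: "Lp_le M p (e j) (\<epsilon> j)" for j
  proof (cases "j = 0")
    case True
    have "norm \<mu> \<le> m"
      using Lp_le_expectation(2)[OF Lp_y[OF p(1), of 0] p(1)] by (simp add: m_def \<mu>_def p_def)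
    hence "cmod H * norm \<mu> \<le> sqrt (real Mb) * m" using H m by (intro mult_mono) auto
    moreover have "e j = (\<lambda>\<omega>. H *s cvec (- \<mu>))" using True by (auto simp: e_def muh0)
    moreover have "norm (H *s cvec (- \<mu>)) = cmod H * norm \<mu>" by (simp add: norm_smult_vec)
    ultimately show ?thesis
      using Lp_le_weaken[OF Lp_le_const[of p "H *s cvec (- \<mu>)"]] True p by (simp add: \<epsilon>_def)
  next
    case False
    thus ?thesis using Lp_mean_error[of "2 * q" j] q
      by (simp add: e_def[abs_def] muh_avg \<epsilon>_def C_def p_def)
  qed
  have DL: "Lp_le M p (D j) C" for j
    using Lp_D[of "2 * q" j] q by (simp add: p_def C_def)
  let ?R = "\<lambda>j \<omega>. outer (e j \<omega>) (e j \<omega>) - (outer (D j \<omega>) (e j \<omega>) + outer (e j \<omega>) (D j \<omega>))"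
  have RL: "Lp_le M (2 * q) (?R j) (\<epsilon> j * \<epsilon> j + (C * \<epsilon> j + \<epsilon> j * C))" for j
    by (intro Lp_le_diff Lp_le_add Lp_outer[OF q] DL[unfolded p_def] eL[unfolded p_def] p)
  have "Lp_le M (2 * q) (\<lambda>\<omega>. (\<Sum>j<k. outer (D j \<omega>) (D j \<omega>) - Phi) + (\<Sum>j<k. ?R j \<omega>))
     (2 * sqrt (A * real k) + (\<Sum>j<k. \<epsilon> j * \<epsilon> j + (C * \<epsilon> j + \<epsilon> j * C)))"
    unfolding A_def C_def using p RL[unfolded C_def]
    by (intro Lp_le_add Lp_le_sum Lp_outer_D_sum[OF q]) auto
  moreover have "(\<Sum>j<k. outer (D j \<omega>) (D j \<omega>) - Phi) + (\<Sum>j<k. ?R j \<omega>) = real k *\<^sub>R (Phih k \<omega> - Phi)" for \<omega>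
  proof -
    have "real k *\<^sub>R Phih k \<omega> = (\<Sum>j<k. outer (D j \<omega> - e j \<omega>) (D j \<omega> - e j \<omega>))"
      unfolding e_def by (rule running_average) (rule Phih)
    also have "\<dots> = (\<Sum>j<k. outer (D j \<omega>) (D j \<omega>) + ?R j \<omega>)"
      by (simp add: outer_diff_left outer_diff_right algebra_simps)
    finally show ?thesis by (simp add: sum.distrib sum_subtractf scaleR_diff_right sum_constant_scaleR del: sum_constant)
  qed
  ultimately have "Lp_le M (2 * q) (\<lambda>\<omega>. real k *\<^sub>R (Phih k \<omega> - Phi))
     (2 * sqrt (A * real k) + (\<Sum>j<k. \<epsilon> j * \<epsilon> j + (C * \<epsilon> j + \<epsilon> j * C)))" by simp
  note L = this
  have "Lp_le M (2 * q) (\<lambda>\<omega>. (1 / real k) *\<^sub>R (real k *\<^sub>R (Phih k \<omega> - Phi)))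
     (1 / real k * (2 * sqrt (A * real k) + (\<Sum>j<k. \<epsilon> j * \<epsilon> j + (C * \<epsilon> j + \<epsilon> j * C))))"
    by (rule Lp_le_scale[OF L borel_measurable_scaleR[OF borel_measurable_const Lp_le_measurable[OF L]]])
      (use p in auto)
  moreover have "(1 / real k) *\<^sub>R (real k *\<^sub>R (Phih k \<omega> - Phi)) = Phih k \<omega> - Phi" for \<omega>
    using k by simp
  ultimately have L: "Lp_le M q (\<lambda>\<omega>. Phih k \<omega> - Phi)
     (1 / real k * (2 * sqrt (A * real k) + (\<Sum>j<k. \<epsilon> j * \<epsilon> j + (C * \<epsilon> j + \<epsilon> j * C))))"
    using Lp_le_halve[OF _ q] by (simp only:)
  \<comment> \<open>Index 0 gives the \<open>Mb\<close> part, using \<open>sqrt Mb \<le> Mb\<close>.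
    For later \<open>j\<close> each of the three terms is at most \<open>C * C * N / sqrt j\<close>,
    and the sum of \<open>1 / sqrt j\<close> is at most \<open>2 * sqrt k\<close>, whence 6.\<close>
  have "(\<Sum>j<k. \<epsilon> j * \<epsilon> j + (C * \<epsilon> j + \<epsilon> j * C))
      \<le> (m\<^sup>2 + 2 * C * m) * real Mb + 6 * C * (C * N) * sqrt (real k)"
  proof -
    have "{..<k} = insert 0 {1..<k}" using k by auto
    hence "(\<Sum>j<k. \<epsilon> j * \<epsilon> j + (C * \<epsilon> j + \<epsilon> j * C))
       = (\<epsilon> 0 * \<epsilon> 0 + (C * \<epsilon> 0 + \<epsilon> 0 * C)) + (\<Sum>j\<in>{1..<k}. \<epsilon> j * \<epsilon> j + (C * \<epsilon> j + \<epsilon> j * C))"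
      by simp
    also have "\<epsilon> 0 * \<epsilon> 0 + (C * \<epsilon> 0 + \<epsilon> 0 * C) \<le> (m\<^sup>2 + 2 * C * m) * real Mb"
    proof -
      have "sqrt (real Mb) \<le> real Mb"
        using Mb_pos by (intro real_le_lsqrt) (auto simp: power2_eq_square)
      hence "2 * C * m * sqrt (real Mb) \<le> 2 * C * m * real Mb" using C m by (intro mult_left_mono) auto
      thus ?thesis by (simp add: \<epsilon>_def power2_eq_square algebra_simps)
    qed
    also have "(\<Sum>j\<in>{1..<k}. \<epsilon> j * \<epsilon> j + (C * \<epsilon> j + \<epsilon> j * C)) \<le> (\<Sum>j\<in>{1..<k}. 3 * (C * C * N) * (1 / sqrt (real j)))"
    proof (rule sum_mono)
      fix j assume "j \<in> {1..<k}"
      hence j: "1 \<le> real j" by auto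
      have N: "sqrt N \<le> N" using N_ge_1 by (intro real_le_lsqrt) (auto simp: power2_eq_square)
      have sj: "sqrt (real j) \<le> real j" using j by (intro real_le_lsqrt) (auto simp: power2_eq_square)
      have "sqrt (N / real j) * sqrt (N / real j) = N / real j"
        using j N_ge_1 by (intro real_sqrt_mult_self[THEN trans]) auto
      hence "\<epsilon> j * \<epsilon> j = C * C * (N / real j)"
        using j by (simp add: \<epsilon>_def mult_ac)
      also have "\<dots> \<le> C * C * (N / sqrt (real j))"
        using C N_ge_1 j sj by (intro mult_left_mono divide_left_mono) auto
      finally have 1: "\<epsilon> j * \<epsilon> j \<le> C * C * N * (1 / sqrt (real j))" by simp
      have "C * \<epsilon> j = C * C * (sqrt N / sqrt (real j))"
        using j by (simp add: \<epsilon>_def real_sqrt_divide)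
      also have "\<dots> \<le> C * C * (N / sqrt (real j))"
        using C N by (intro mult_left_mono divide_right_mono) auto
      finally have 2: "C * \<epsilon> j \<le> C * C * N * (1 / sqrt (real j))" by simp
      show "\<epsilon> j * \<epsilon> j + (C * \<epsilon> j + \<epsilon> j * C) \<le> 3 * (C * C * N) * (1 / sqrt (real j))"
        using 1 2 unfolding mult.commute[of "\<epsilon> j" C] mult.assoc by linarith
    qed
    also have "\<dots> = 3 * (C * C * N) * (\<Sum>j\<in>{1..<k}. 1 / sqrt (real j))" by (simp only: sum_distrib_left)
    also have "\<dots> \<le> 3 * (C * C * N) * (2 * sqrt (real k))"
    proof (rule mult_left_mono)
      have "(\<Sum>j\<in>{1..<k}. 1 / sqrt (real j)) \<le> (\<Sum>j=1..k. 1 / sqrt (real j))"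
        by (intro sum_mono2) auto
      thus "(\<Sum>j\<in>{1..<k}. 1 / sqrt (real j)) \<le> 2 * sqrt (real k)"
        using sum_inverse_sqrt_le[of k] by linarith
    qed (use C N_ge_1 in auto)
    finally show ?thesis by (simp add: mult_ac)
  qed
  moreover have "2 * sqrt (A * real k)
      \<le> 4 * sqrt (6 * (2 * q - 1) * C ^ 3 * c2 M Fp K Mb y (2 * q)) * sqrt (real k)"
  proof -
    \<comment> \<open>Here \<open>A = 2 * B\<close>, and \<open>sqrt 2 \<le> 2\<close> turns the
      leading 2 into the 4 of \<open>bq\<close>.\<close>
    define B where "B = 6 * (2 * q - 1) * C ^ 3 * c2 M Fp K Mb y (2 * q)"
    have "0 \<le> c2 M Fp K Mb y (2 * q)" unfolding c2_def using C by (simp add: C_def)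
    hence "0 \<le> B" unfolding B_def using C q by simp
    have "A = 2 * B" by (simp add: A_def B_def power3_eq_cube power2_eq_square)
    hence "sqrt A \<le> sqrt (4 * B)" using \<open>0 \<le> B\<close> by simp
    also have "\<dots> = 2 * sqrt B" by (simp add: real_sqrt_mult)
    finally have "sqrt A * sqrt (real k) \<le> 2 * sqrt B * sqrt (real k)" by (rule mult_right_mono) simp
    thus ?thesis unfolding B_def[symmetric] real_sqrt_mult[of A] by linarith
  qed
  moreover have "0 \<le> 2 * (C * N)\<^sup>2 * sqrt (real k)" by simp
  moreover have bq: "bq M Fp K Mb y q = 4 * sqrt (6 * (2 * q - 1) * C ^ 3 * c2 M Fp K Mb y (2 * q))
      + 6 * C * (C * N) + 2 * (C * N)\<^sup>2"
    by (simp add: bq_def cc_def C_def N_def)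
  ultimately have "2 * sqrt (A * real k) + (\<Sum>j<k. \<epsilon> j * \<epsilon> j + (C * \<epsilon> j + \<epsilon> j * C))
      \<le> bq M Fp K Mb y q * sqrt (real k) + (m\<^sup>2 + 2 * C * m) * real Mb"
    unfolding bq distrib_right by linarith
  hence "1 / real k * (2 * sqrt (A * real k) + (\<Sum>j<k. \<epsilon> j * \<epsilon> j + (C * \<epsilon> j + \<epsilon> j * C)))
     \<le> 1 / real k * (bq M Fp K Mb y q * sqrt (real k) + (m\<^sup>2 + 2 * C * m) * real Mb)"
    by (rule mult_left_mono) simp
  also have "\<dots> = bq M Fp K Mb y q * (sqrt (real k) / real k) + (m\<^sup>2 + 2 * C * m) * (real Mb / real k)"
    by (simp add: distrib_left)
  also have "sqrt (real k) / real k = 1 / sqrt (real k)" by (simp add: sqrt_divide_self_eq inverse_eq_divide)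
  finally show ?thesis using Lp_le_weaken[OF L] q unfolding m_def C_def by simp
qed

end

section \<open>The bound for the online algorithm\<close>

theorem theorem3:
  fixes M :: "'a measure"
    and F Fp :: "nat \<Rightarrow> 'a measure"
    and y :: "nat \<Rightarrow> 'a \<Rightarrow> real^'n"
    and K Mb :: nat
    and w :: "nat \<Rightarrow> real \<Rightarrow> complex"
    and muh :: "nat \<Rightarrow> 'a \<Rightarrow> real^'n"
    and Phih :: "nat \<Rightarrow> real \<Rightarrow> 'a \<Rightarrow> complex^'n^'n"
  assumes "prob_space M"
    and "filtration_pair M F Fp"
    and "stationary M y"
    and "L_mixing M F Fp y"
    and "1 \<le> K" and "K \<le> Mb"
    and "\<forall>s. (\<Sum>k<Mb. (cmod (w k s))\<^sup>2) = 1"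
    and "\<forall>\<omega>. muh 0 \<omega> = 0"
    and "\<forall>j \<omega>. muh (Suc j) \<omega> =
            muh j \<omega> + (1 / real (j + 1)) *\<^sub>R (ybar K Mb y j \<omega> - muh j \<omega>)"
    and "\<forall>j s \<omega>. Phih (Suc j) s \<omega> =
            Phih j s \<omega> + (1 / real (j + 1)) *\<^sub>R
              (outer (yhat K Mb w y j s \<omega> - hw Mb w s *s cvec (muh j \<omega>))
                     (yhat K Mb w y j s \<omega> - hw Mb w s *s cvec (muh j \<omega>))
               - Phih j s \<omega>)"
    and "2 \<le> k"
    and "1 \<le> q"
  shows "Lq_norm M q (\<lambda>\<omega>. Phih k s \<omega> - Phibar M K Mb w y s)
           \<le> ennreal (bq M Fp K Mb y q * (1 / sqrt (real k))
              + ((enn2real (Mq M (4 * q) y))\<^sup>2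
                 + 2 * c1 M Fp y (2 * q) * enn2real (Mq M (4 * q) y)) * (real Mb / real k))"
proof -
  interpret prob_space M by fact
  interpret spectral_estimator M F Fp y K Mb "\<lambda>k. w k s"
    using assms by unfold_locales auto
  have H: "hw Mb w s = H" by (simp add: hw_def H_def)
  \<comment> \<open>At \<open>v = muh j \<omega>\<close> this rewrites the recursion in terms of the
    mean error; at \<open>v = \<mu>\<close> it identifies \<open>Phibar\<close> with
    \<open>Phi\<close>.\<close>
  have D: "yhat K Mb w y j s \<omega> - hw Mb w s *s cvec v = D j \<omega> - H *s cvec (v - \<mu>)" for j \<omega> v
    unfolding yhat_def D_def H_def hw_def
    by (simp add: cvec_diff vec_eq_iff algebra_simps sum.distrib sum_subtractf sum_distrib_left sum_distrib_right)
  have "Phibar M K Mb w y s = Phi"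
    using D[of 0 _ \<mu>] by (simp add: Phibar_def Phi_def Let_def \<mu>_def[symmetric] vector_smult_rzero)
  moreover have "Lp_le M q (\<lambda>\<omega>. Phih k s \<omega> - Phi)
    (bq M Fp K Mb y q * (1 / sqrt (real k))
      + ((mom (4 * q))\<^sup>2 + 2 * c1 M Fp y (2 * q) * mom (4 * q)) * (real Mb / real k))"
  proof (rule Lp_covariance_error[where muh = muh and Phih = "\<lambda>j. Phih j s"])
    show "Phih (Suc j) s \<omega> = Phih j s \<omega> + (1 / real (j + 1)) *\<^sub>R
      (outer (D j \<omega> - H *s cvec (muh j \<omega> - \<mu>)) (D j \<omega> - H *s cvec (muh j \<omega> - \<mu>)) - Phih j s \<omega>)" for j \<omega>
      unfolding D[symmetric] using assms(10) by blast
  qed (use assms in auto)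
  ultimately show ?thesis
    \<comment> \<open>Measurability of the estimate and nonnegativity of the bound both come with
      the \<open>Lp_le\<close> statement.\<close>
    using assms by (subst Lq_norm_le_iff) (auto dest: Lp_le_measurable Lp_le_nonneg)
qed

end
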